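(* Let $m>5/2$ be an integer, let $v_0\in\mathbb{H}^m_\sigma$, let $0<T_*<\infty$, and let $v\in C([0,T_* );\mathbb{H}^m_\sigma)$ be the classical solution on $\mathbb{T}^3$ of the 3D Euler equations $$\frac{\partial v}{\partial t}+(v\cdot\nabla)v=-\nabla p,\qquad \operatorname{div} v=0,\qquad v(x,0)=v_0(x).$$ Let $\lambda_1(x,t)\ge\lambda_2(x,t)\ge\lambda_3(x,t)$ be the eigenvalues of the deformation tensor $S_{ij}(v)=\frac12\left(\frac{\partial v_j}{\partial x_i}+\frac{\partial v_i}{\partial x_j}\right)$, let $\lambda_2^+(x,t)=\max\{\lambda_2(x,t),0\}$, and let $\omega=\operatorname{curl} v$. Suppose $$\limsup_{t\to T_*}\|\omega(t)\|_{L^2}=\infty.$$ Then necessarily $$\int_0^{T_*}\|\lambda_2^+(t)\|_{L^\infty}\,dt=\infty.$$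
   Context: $\mathbb{T}^3$ is the 3D periodic box (all functions are periodic in space). $v=(v_1,v_2,v_3)$ is the velocity and $p$ the scalar pressure. $H^m(\mathbb{T}^3)$ is the standard $L^2$-based Sobolev space and $\mathbb{H}^m_\sigma=\{u\in[H^m(\mathbb{T}^3)]^3 : \operatorname{div} u=0\}$. $\|\cdot\|_{L^2}$ and $\|\cdot\|_{L^\infty}$ are the norms of $L^2(\mathbb{T}^3)$ and $L^\infty(\mathbb{T}^3)$ in the space variable. *)

theory Defs
  imports "HOL-Analysis.Analysis" "HOL-Probability.Essential_Supremum"
begin

text \<open>
  The torus is \<open>\<real>\<^sup>3\<close> modulo \<open>\<int>\<^sup>3\<close>: functions on it are functions on \<open>\<real>\<^sup>3\<close> of period 1 in each
  coordinate, and integration is over one period cell.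
\<close>

abbreviation torus :: "(real^3) measure"
  where "torus \<equiv> lebesgue_on (cbox 0 1)"

definition periodic :: "(real^3 \<Rightarrow> 'a) \<Rightarrow> bool"
  where "periodic f \<longleftrightarrow> (\<forall>x i. f (x + axis i 1) = f x)"

definition partial :: "3 \<Rightarrow> (real^3 \<Rightarrow> real) \<Rightarrow> real^3 \<Rightarrow> real"
  where "partial j f x = frechet_derivative f (at x) (axis j 1)"

text \<open>Continuously differentiable on \<open>S\<close>; used for open \<open>S\<close> only.\<close>

definition C1_on :: "'a::euclidean_space set \<Rightarrow> ('a \<Rightarrow> 'b::real_normed_vector) \<Rightarrow> bool"
  where "C1_on S f \<longleftrightarrow>
    (\<forall>x\<in>S. f differentiable (at x)) \<and>
    (\<forall>h. continuous_on S (\<lambda>x. frechet_derivative f (at x) h))"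


definition L2_torus :: "(real^3 \<Rightarrow> real) set"
  where "L2_torus = {f. periodic f \<and> f \<in> borel_measurable torus \<and> integrable torus (\<lambda>x. (f x)\<^sup>2)}"

definition L2_norm :: "(real^3 \<Rightarrow> 'a::{banach, second_countable_topology}) \<Rightarrow> real"
  where "L2_norm f = sqrt (LINT x|torus. (norm (f x))\<^sup>2)"

definition Linf_norm :: "(real^3 \<Rightarrow> real) \<Rightarrow> ennreal"
  where "Linf_norm f = esssup torus (\<lambda>x. ennreal \<bar>f x\<bar>)"


text \<open>
  First order weak derivatives on the torus. Testing with periodic \<open>C\<^sup>1\<close> functions is the same as
  testing with smooth ones, by density.
\<close>

definition has_weak_partial :: "3 \<Rightarrow> (real^3 \<Rightarrow> real) \<Rightarrow> (real^3 \<Rightarrow> real) \<Rightarrow> bool"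
  where "has_weak_partial j f g \<longleftrightarrow>
    (\<forall>\<phi>. periodic \<phi> \<and> C1_on UNIV \<phi> \<longrightarrow>
      (LINT x|torus. f x * partial j \<phi> x) = - (LINT x|torus. g x * \<phi> x))"

text \<open>A weak derivative in \<open>L\<^sup>2\<close> is unique up to null sets, so the choice below is immaterial.\<close>

definition weak_partial :: "3 \<Rightarrow> (real^3 \<Rightarrow> real) \<Rightarrow> real^3 \<Rightarrow> real"
  where "weak_partial j f = (SOME g. g \<in> L2_torus \<and> has_weak_partial j f g)"

text \<open>
  \<open>H\<^sup>m\<close> consists of the \<open>L\<^sup>2\<close> functions all of whose weak derivatives of order at most \<open>m\<close> are
  in \<open>L\<^sup>2\<close>. The squared norm sums the squared \<open>L\<^sup>2\<close> norms of the iterated derivatives along all words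
  of length at most \<open>m\<close> in the coordinate directions; it differs from the sum over multi-indices
  only by multinomial weights, so the two norms are equivalent.
\<close>

primrec sobolev :: "nat \<Rightarrow> (real^3 \<Rightarrow> real) set"
  where
    "sobolev 0 = L2_torus"
  | "sobolev (Suc m) = {f \<in> L2_torus. \<forall>j. \<exists>g\<in>sobolev m. has_weak_partial j f g}"

primrec sobolev_norm_sq :: "nat \<Rightarrow> (real^3 \<Rightarrow> real) \<Rightarrow> real"
  where
    "sobolev_norm_sq 0 f = (L2_norm f)\<^sup>2"
  | "sobolev_norm_sq (Suc m) f =
      (L2_norm f)\<^sup>2 + (\<Sum>j\<in>UNIV. sobolev_norm_sq m (weak_partial j f))"

definition sobolev_sigma :: "nat \<Rightarrow> (real^3 \<Rightarrow> real^3) set"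
  where "sobolev_sigma m = {u.
    (\<forall>i. (\<lambda>x. u x $ i) \<in> sobolev m) \<and>
    (AE x in torus. (\<Sum>j\<in>UNIV. weak_partial j (\<lambda>y. u y $ j) x) = 0)}"

definition vec_sobolev_norm :: "nat \<Rightarrow> (real^3 \<Rightarrow> real^3) \<Rightarrow> real"
  where "vec_sobolev_norm m u = sqrt (\<Sum>i\<in>UNIV. sobolev_norm_sq m (\<lambda>x. u x $ i))"

text \<open>The space \<open>C([0,T); H\<^sup>m\<^sub>\<sigma>)\<close>; the time argument comes first.\<close>

definition cont_into_sobolev_sigma :: "nat \<Rightarrow> real \<Rightarrow> (real \<Rightarrow> real^3 \<Rightarrow> real^3) \<Rightarrow> bool"
  where "cont_into_sobolev_sigma m T v \<longleftrightarrow>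
    (\<forall>t\<in>{0..<T}. v t \<in> sobolev_sigma m) \<and>
    (\<forall>s\<in>{0..<T}. ((\<lambda>t. vec_sobolev_norm m (\<lambda>x. v t x - v s x)) \<longlongrightarrow> 0) (at s within {0..<T}))"


definition gradient :: "(real^3 \<Rightarrow> real) \<Rightarrow> real^3 \<Rightarrow> real^3"
  where "gradient f x = (\<chi> i. partial i f x)"

definition divergence :: "(real^3 \<Rightarrow> real^3) \<Rightarrow> real^3 \<Rightarrow> real"
  where "divergence u x = (\<Sum>i\<in>UNIV. partial i (\<lambda>y. u y $ i) x)"

definition convect :: "(real^3 \<Rightarrow> real^3) \<Rightarrow> (real^3 \<Rightarrow> real^3) \<Rightarrow> real^3 \<Rightarrow> real^3"
  where "convect u w x = (\<chi> i. \<Sum>j\<in>UNIV. u x $ j * partial j (\<lambda>y. w y $ i) x)"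

definition curl :: "(real^3 \<Rightarrow> real^3) \<Rightarrow> real^3 \<Rightarrow> real^3"
  where "curl u x = vector
    [partial 2 (\<lambda>y. u y $ 3) x - partial 3 (\<lambda>y. u y $ 2) x,
     partial 3 (\<lambda>y. u y $ 1) x - partial 1 (\<lambda>y. u y $ 3) x,
     partial 1 (\<lambda>y. u y $ 2) x - partial 2 (\<lambda>y. u y $ 1) x]"

definition deformation :: "(real^3 \<Rightarrow> real^3) \<Rightarrow> real^3 \<Rightarrow> real^3^3"
  where "deformation u x =
    (\<chi> i j. (partial i (\<lambda>y. u y $ j) x + partial j (\<lambda>y. u y $ i) x) / 2)"

text \<open>The eigenvalues of \<open>A\<close>, counted with algebraic multiplicity, in decreasing order.\<close>

definition ordered_eigenvalues :: "real^3^3 \<Rightarrow> real \<Rightarrow> real \<Rightarrow> real \<Rightarrow> bool"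
  where "ordered_eigenvalues A a b c \<longleftrightarrow>
    a \<ge> b \<and> b \<ge> c \<and> (\<forall>z. det (mat z - A) = (z - a) * (z - b) * (z - c))"

text \<open>
  The pressure is only required to be differentiable in space; its gradient is then continuous by
  the equation. The equations are imposed at positive times, with the initial condition at time 0
  attained in \<open>H\<^sup>m\<close> by continuity.
\<close>

definition classical_euler_solution ::
    "nat \<Rightarrow> real \<Rightarrow> (real^3 \<Rightarrow> real^3) \<Rightarrow> (real \<Rightarrow> real^3 \<Rightarrow> real^3) \<Rightarrow> (real \<Rightarrow> real^3 \<Rightarrow> real) \<Rightarrow> bool"
  where "classical_euler_solution m T v0 v p \<longleftrightarrow>
    cont_into_sobolev_sigma m T v \<and>
    C1_on ({0<..<T} \<times> UNIV) (\<lambda>(t, x). v t x) \<and>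
    (\<forall>t\<in>{0<..<T}. periodic (p t) \<and> (\<forall>x. p t differentiable (at x))) \<and>
    (\<forall>t\<in>{0<..<T}. \<forall>x.
      vector_derivative (\<lambda>s. v s x) (at t) + convect (v t) (v t) x = - gradient (p t) x \<and>
      divergence (v t) x = 0) \<and>
    (\<forall>x. v 0 x = v0 x)"

end

theory Submission
  imports Defs
begin

text \<open>
  The blow-up of the enstrophy is governed by the middle eigenvalue of the strain. Write \<open>A\<close> for the
  velocity gradient and \<open>S\<close> for its symmetric part, the deformation tensor. Formally, testing the Euler
  equations with \<open>- \<Delta> v\<close> gives
  \<open>d/dt \<integral> |A|\<^sup>2 = - 2 \<integral> tr (A\<^sup>2 A\<^sup>T)\<close>. Since \<open>A\<close> is trace free, the integrand is \<open>4 det S - det A\<close>, and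
  \<open>det A\<close> is a null Lagrangian, hence integrates to zero; so does \<open>tr A\<^sup>2\<close>, and therefore
  \<open>\<integral> |A|\<^sup>2 = \<integral> |curl v|\<^sup>2 = 2 \<integral> |S|\<^sup>2\<close>. Consequently
  \<open>d/dt \<integral> |curl v|\<^sup>2 = - 8 \<integral> \<lambda>\<^sub>1 \<lambda>\<^sub>2 \<lambda>\<^sub>3\<close>. The eigenvalues of \<open>S\<close> sum to zero, so the product is negative
  only where \<open>\<lambda>\<^sub>2 > 0\<close>, and there \<open>- 2 \<lambda>\<^sub>1 \<lambda>\<^sub>3 \<le> \<lambda>\<^sub>1\<^sup>2 + \<lambda>\<^sub>3\<^sup>2 \<le> |S|\<^sup>2\<close>. The right hand side is thus at
  most \<open>2 \<parallel>\<lambda>\<^sub>2\<^sup>+\<parallel>\<^sub>\<infinity> \<integral> |curl v|\<^sup>2\<close>, and by the inequality of Gronwall a finite time integral of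
  \<open>\<parallel>\<lambda>\<^sub>2\<^sup>+\<parallel>\<^sub>\<infinity>\<close> keeps the vorticity bounded in \<open>L\<^sup>2\<close>.

  The proof below makes this rigorous with first derivatives alone. A solution is \<open>C\<^sup>1\<close> in space and
  time, and every integration by parts that would involve second derivatives is performed exactly on
  finite differences: the Euler nonlinearity in
  \<open>cell_int_incr_euler\<close>, the trace of \<open>A\<^sup>2\<close> in \<open>cell_int_trace_square\<close>, and the determinant, via a discrete
  cup product, in \<open>cell_int_det_grad\<close>. The resulting identities contain first order difference
  quotients only, which converge uniformly as the step tends to zero. This yields the enstrophy balance
  \<open>enstrophy_derivative\<close>; the pointwise and integrated eigenvalue estimates are
  \<open>det_bound_middle_eigenvalue\<close> and \<open>growth_bound\<close>, and \<open>enstrophy_gronwall\<close> concludes.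
\<close>

section \<open>Continuous functions on the torus and their integral over a cell\<close>

definition torus_cont :: "(real^3 \<Rightarrow> real) \<Rightarrow> bool"
  where "torus_cont f \<longleftrightarrow> periodic f \<and> continuous_on UNIV f"

definition cell_int :: "(real^3 \<Rightarrow> real) \<Rightarrow> real"
  where "cell_int f = integral (cbox 0 1) f"

lemma torus_cont_arith [intro, simp]:
  "torus_cont (\<lambda>x. c)"
  "torus_cont f \<Longrightarrow> torus_cont g \<Longrightarrow> torus_cont (\<lambda>x. f x + g x)"
  "torus_cont f \<Longrightarrow> torus_cont g \<Longrightarrow> torus_cont (\<lambda>x. f x - g x)"
  "torus_cont f \<Longrightarrow> torus_cont g \<Longrightarrow> torus_cont (\<lambda>x. f x * g x)"
  "torus_cont f \<Longrightarrow> torus_cont (\<lambda>x. - f x)"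
  "torus_cont f \<Longrightarrow> torus_cont (\<lambda>x. f x ^ n)"
  "torus_cont f \<Longrightarrow> torus_cont (\<lambda>x. f x / c)"
  by (auto simp: torus_cont_def periodic_def divide_inverse intro!: continuous_intros)

lemma torus_cont_sum [intro, simp]:
  "(\<And>i. i \<in> I \<Longrightarrow> torus_cont (f i)) \<Longrightarrow> torus_cont (\<lambda>x. \<Sum>i\<in>I. f i x)"
  by (induction I rule: infinite_finite_induct) auto

lemma torus_cont_shift [intro, simp]:
  assumes "torus_cont f" shows "torus_cont (\<lambda>x. f (x + y))"
proof -
  have "f (x + axis i 1 + y) = f (x + y)" for x i
    using assms by (simp add: torus_cont_def periodic_def add.assoc add.commute[of _ y])
      (metis add.assoc)
  moreover have "continuous_on UNIV (\<lambda>x. f (x + y))"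
    by (rule continuous_on_compose2[of UNIV f]) (use assms in \<open>auto simp: torus_cont_def intro!: continuous_intros\<close>)
  ultimately show ?thesis by (auto simp: torus_cont_def periodic_def)
qed

lemma torus_cont_integrable [intro, simp]:
  "torus_cont f \<Longrightarrow> f integrable_on (cbox a b)"
  by (auto simp: torus_cont_def intro: integrable_continuous continuous_on_subset)

lemma cell_int_arith:
  "torus_cont f \<Longrightarrow> torus_cont g \<Longrightarrow> cell_int (\<lambda>x. f x + g x) = cell_int f + cell_int g"
  "torus_cont f \<Longrightarrow> torus_cont g \<Longrightarrow> cell_int (\<lambda>x. f x - g x) = cell_int f - cell_int g"
  "cell_int (\<lambda>x. - f x) = - cell_int f"
  "cell_int (\<lambda>x. c * f x) = c * cell_int f"
  "cell_int (\<lambda>x. f x * c) = cell_int f * c"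
  "cell_int (\<lambda>x. f x / c) = cell_int f / c"
  "cell_int (\<lambda>x. 0) = 0"
  by (simp_all add: cell_int_def integral_add integral_diff)

lemma cell_int_sum:
  "finite I \<Longrightarrow> (\<And>i. i \<in> I \<Longrightarrow> torus_cont (f i)) \<Longrightarrow>
   cell_int (\<lambda>x. \<Sum>i\<in>I. f i x) = (\<Sum>i\<in>I. cell_int (f i))"
  by (auto simp: cell_int_def intro!: integral_sum)

text \<open>
  All integration by parts below rests on this translation invariance, by passing to the limit in
  difference quotients. It holds because cutting the shifted cell at
  the face \<open>x\<^sub>j = 1\<close> and moving the outer slab back by one period reassembles the original cell.
\<close>

lemma cell_int_shift:
  assumes f: "torus_cont f" and h: "0 \<le> h" "h \<le> 1"
  shows "cell_int (\<lambda>x. f (x + h *\<^sub>R axis j 1)) = cell_int f"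
proof -
  let ?e = "axis j 1 :: real^3"
  let ?c = "h *\<^sub>R ?e"
  have e: "?e \<in> Basis" by auto
  have inn: "x \<bullet> ?e = x $ j" for x by (simp add: inner_axis)
  have ax: "?e $ i = (if i = j then 1 else 0)" for i by (simp add: axis_def)
  \<comment> \<open>The slab beyond the face \<open>x\<^sub>j = 1\<close> is the translate by one period of the box from \<open>0\<close> to \<open>b\<close>.\<close>
  define b where "b = (\<chi> i. if i = j then h else (1::real))"
  have per: "f (x + ?e) = f x" for x
    using f by (auto simp: torus_cont_def periodic_def)
  have split: "integral (cbox ?c (1 + ?c)) f =
     integral (cbox ?c 1) f + integral (cbox ?e (1 + ?c)) f"
  proof -
    have 1: "cbox ?c (1 + ?c) \<inter> {x. x \<bullet> ?e \<le> 1} = cbox ?c 1"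
      using h by (auto simp: mem_box_cart inn ax split: if_splits; smt (verit))
    have 2: "cbox ?c (1 + ?c) \<inter> {x. x \<bullet> ?e \<ge> 1} = cbox ?e (1 + ?c)"
      using h by (auto simp: mem_box_cart inn ax split: if_splits; smt (verit))
    show ?thesis
      using integral_split[OF torus_cont_integrable[OF f] e, of ?c "1 + ?c" 1] 1 2 by simp
  qed
  have split0: "integral (cbox 0 1) f = integral (cbox 0 b) f + integral (cbox ?c 1) f"
  proof -
    have 1: "cbox 0 1 \<inter> {x. x \<bullet> ?e \<le> h} = cbox 0 b"
      using h by (auto simp: mem_box_cart inn b_def split: if_splits; smt (verit))
    have 2: "cbox 0 1 \<inter> {x. x \<bullet> ?e \<ge> h} = cbox ?c 1"
      using h by (auto simp: mem_box_cart inn ax split: if_splits; smt (verit))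
    show ?thesis
      using integral_split[OF torus_cont_integrable[OF f] e, of 0 1 h] 1 2 by simp
  qed
  have b: "1 + ?c - ?e = b"
    by (auto simp: vec_eq_iff b_def axis_def)
  have "integral (cbox ?e (1 + ?c)) f = integral (cbox 0 b) f"
    using integral_shift_cbox[of ?e ?e "1 + ?c" f] by (simp add: per b)
  moreover have "integral (cbox 0 1) (\<lambda>x. f (x + ?c)) = integral (cbox ?c (1 + ?c)) f"
    using integral_shift_cbox[of ?c ?c "1 + ?c" f] by simp
  ultimately show ?thesis
    using split split0 by (simp add: cell_int_def)
qed

section \<open>Difference quotients and integration by parts\<close>

lemma line_derivative:
  fixes f :: "real^3 \<Rightarrow> real"
  assumes "\<And>x. ((\<lambda>s. f (x + s *\<^sub>R e)) has_real_derivative g x) (at 0)"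
  shows "((\<lambda>s. f (x + s *\<^sub>R e)) has_real_derivative g (x + s *\<^sub>R e)) (at s)"
proof -
  have "((\<lambda>r. f ((x + s *\<^sub>R e) + r *\<^sub>R e)) has_real_derivative g (x + s *\<^sub>R e)) (at 0)"
    by (rule assms)
  then show ?thesis
    using DERIV_shift[of "\<lambda>s. f (x + s *\<^sub>R e)" "g (x + s *\<^sub>R e)" 0 s]
    by (simp add: algebra_simps scaleR_add_left)
qed

text \<open>
  By the mean value theorem the quotient is a value of \<open>G\<close> at distance at most
  \<open>h (norm z + norm e)\<close> from \<open>x\<close>, so uniform continuity on a compact set suffices. The parameter \<open>t\<close>
  later is time; the base point moves by \<open>h z\<close> because shifted differences arise from the discrete
  product rule.
\<close>

lemma diffquot_uniform_limit:
  fixes F G :: "'p::metric_space \<Rightarrow> real^3 \<Rightarrow> real" and z :: "real^3"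
  assumes K: "compact K" and G: "continuous_on (K \<times> UNIV) (\<lambda>(t, x). G t x)"
    and D: "\<And>t x. t \<in> K \<Longrightarrow> ((\<lambda>s. F t (x + s *\<^sub>R e)) has_real_derivative G t x) (at 0)"
  shows "uniform_limit (K \<times> cbox 0 1)
     (\<lambda>h (t, x). (F t (x + h *\<^sub>R z + h *\<^sub>R e) - F t (x + h *\<^sub>R z)) / h) (\<lambda>(t, x). G t x) (at_right 0)"
proof (rule uniform_limitI)
  fix \<epsilon> :: real assume \<epsilon>: "\<epsilon> > 0"
  define M where "M = norm z + norm e + 1"
  have M: "M > 0" by (auto simp: M_def add_nonneg_pos)
  obtain R where R: "\<And>x. x \<in> cbox 0 (1::real^3) \<Longrightarrow> norm x \<le> R"
    using bounded_cbox[of 0 "1::real^3"] unfolding bounded_iff by blast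
  let ?C = "K \<times> cball (0::real^3) (R + M)"
  have "uniformly_continuous_on ?C (\<lambda>(t, x). G t x)"
    by (intro compact_uniformly_continuous compact_Times K compact_cball)
       (auto intro: continuous_on_subset[OF G])
  then obtain d where d: "d > 0" and
    dG: "\<And>p q. p \<in> ?C \<Longrightarrow> q \<in> ?C \<Longrightarrow> dist q p < d \<Longrightarrow> dist (case q of (t, x) \<Rightarrow> G t x) (case p of (t, x) \<Rightarrow> G t x) < \<epsilon>"
    unfolding uniformly_continuous_on_def using \<epsilon> by metis
  define \<delta> where "\<delta> = min 1 (d / M)"
  have \<delta>: "\<delta> > 0" using d M by (auto simp: \<delta>_def)
  show "\<forall>\<^sub>F h in at_right 0. \<forall>p\<in>K \<times> cbox 0 1. dist (case p of (t, x) \<Rightarrow> (F t (x + h *\<^sub>R z + h *\<^sub>R e) - F t (x + h *\<^sub>R z)) / h)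
         (case p of (t, x) \<Rightarrow> G t x) < \<epsilon>"
    unfolding eventually_at_right_field
  proof (intro exI[of _ \<delta>] conjI \<delta> allI impI ballI)
    fix h :: real and p assume h: "0 < h" "h < \<delta>" and p: "p \<in> K \<times> cbox (0::real^3) 1"
    obtain t x where [simp]: "p = (t, x)" and t: "t \<in> K" and x: "x \<in> cbox 0 1"
      using p by auto
    obtain s where s: "0 < s" "s < h" and
      eq: "F t (x + h *\<^sub>R z + h *\<^sub>R e) - F t (x + h *\<^sub>R z + 0 *\<^sub>R e) = (h - 0) * G t (x + h *\<^sub>R z + s *\<^sub>R e)"
      using MVT2[of 0 h "\<lambda>s. F t (x + h *\<^sub>R z + s *\<^sub>R e)" "\<lambda>s. G t (x + h *\<^sub>R z + s *\<^sub>R e)"]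
        line_derivative[of "F t" e "G t", OF D[OF t]] h by blast
    let ?y = "x + h *\<^sub>R z + s *\<^sub>R e"
    have "norm (h *\<^sub>R z + s *\<^sub>R e) \<le> norm (h *\<^sub>R z) + norm (s *\<^sub>R e)" by (rule norm_triangle_ineq)
    also have "\<dots> \<le> h * norm z + h * norm e" using s h by (auto intro!: mult_right_mono)
    also have "\<dots> < h * M" using h by (auto simp: M_def algebra_simps)
    finally have n: "norm (h *\<^sub>R z + s *\<^sub>R e) < h * M" .
    have "h * M \<le> M" "h * M < d" using h M by (auto simp: \<delta>_def field_simps)
    then have y: "norm (?y - x) < d" "norm (?y - x) \<le> M" using n by auto
    have "norm x \<le> R" using x R by auto
    then have "norm ?y \<le> R + M" using y(2) norm_triangle_ineq[of x "?y - x"] by (simp add: add.assoc)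
    then have "(t, x) \<in> ?C" "(t, ?y) \<in> ?C"
      using t \<open>norm x \<le> R\<close> M by (simp_all only: mem_Sigma_iff mem_cball_0) auto
    then have "dist (G t ?y) (G t x) < \<epsilon>"
      using dG[of "(t, x)" "(t, ?y)"] y(1) by (simp add: dist_Pair_Pair dist_norm)
    then show "dist (case p of (t, x) \<Rightarrow> (F t (x + h *\<^sub>R z + h *\<^sub>R e) - F t (x + h *\<^sub>R z)) / h) (case p of (t, x) \<Rightarrow> G t x) < \<epsilon>"
      using eq h by simp
  qed
qed

text \<open>
  The predicate concerns one direction at a time because each integration by parts does; periodicity
  and continuity are included since they are what makes the integrals shift invariant.
\<close>

definition has_torus_partial :: "3 \<Rightarrow> (real^3 \<Rightarrow> real) \<Rightarrow> (real^3 \<Rightarrow> real) \<Rightarrow> bool"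
  where "has_torus_partial j f g \<longleftrightarrow> torus_cont f \<and> torus_cont g \<and>
    (\<forall>x. ((\<lambda>s. f (x + s *\<^sub>R axis j 1)) has_real_derivative g x) (at 0))"

definition incr :: "real \<Rightarrow> 3 \<Rightarrow> (real^3 \<Rightarrow> real) \<Rightarrow> real^3 \<Rightarrow> real"
  where "incr h j f x = f (x + h *\<^sub>R axis j 1) - f x"

lemma has_torus_partial_cont [dest]:
  assumes "has_torus_partial j f g" shows "torus_cont f" "torus_cont g"
  using assms by (auto simp: has_torus_partial_def)

lemma torus_cont_incr [intro, simp]: "torus_cont f \<Longrightarrow> torus_cont (incr h j f)"
  unfolding incr_def by auto

lemma has_torus_partial_mult:
  assumes "has_torus_partial j f f'" "has_torus_partial j g g'"
  shows "has_torus_partial j (\<lambda>x. f x * g x) (\<lambda>x. f' x * g x + f x * g' x)"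
proof -
  have "((\<lambda>s. f (x + s *\<^sub>R axis j 1) * g (x + s *\<^sub>R axis j 1)) has_real_derivative
      f' x * g x + f x * g' x) (at 0)" for x
    using assms unfolding has_torus_partial_def by (auto intro!: derivative_eq_intros)
  then show ?thesis using assms by (auto simp: has_torus_partial_def)
qed

lemma has_torus_partial_shift:
  assumes "has_torus_partial j f f'"
  shows "has_torus_partial j (\<lambda>x. f (x + y)) (\<lambda>x. f' (x + y))"
proof -
  have "((\<lambda>s. f ((x + y) + s *\<^sub>R axis j 1)) has_real_derivative f' (x + y)) (at 0)" for x
    using assms unfolding has_torus_partial_def by blast
  then show ?thesis using assms by (auto simp: has_torus_partial_def ac_simps)
qed

lemma has_torus_partial_diff:
  assumes "has_torus_partial j f f'" "has_torus_partial j g g'"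
  shows "has_torus_partial j (\<lambda>x. f x - g x) (\<lambda>x. f' x - g' x)"
  using assms unfolding has_torus_partial_def by (auto intro!: derivative_intros)

lemma has_torus_partial_incr:
  "has_torus_partial k f f' \<Longrightarrow> has_torus_partial k (incr h j f) (incr h j f')"
  unfolding incr_def by (intro has_torus_partial_diff has_torus_partial_shift)

lemma diffquot_limit:
  assumes "has_torus_partial j f g"
  shows "uniform_limit (cbox 0 1) (\<lambda>h x. incr h j f (x + h *\<^sub>R z) / h) g (at_right 0)"
proof -
  have "uniform_limit ({0::real} \<times> cbox 0 1)
     (\<lambda>h (t, x). (f (x + h *\<^sub>R z + h *\<^sub>R axis j 1) - f (x + h *\<^sub>R z)) / h) (\<lambda>(t, x). g x) (at_right 0)"
    using assms by (intro diffquot_uniform_limit[of "{0}" "\<lambda>_. g" "\<lambda>_. f"])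
      (auto simp: has_torus_partial_def torus_cont_def split_beta intro!: continuous_on_compose2[of UNIV g] continuous_intros)
  then show ?thesis unfolding uniform_limit_iff incr_def by simp
qed

lemma diffquot_limit0:
  assumes "has_torus_partial j f g"
  shows "uniform_limit (cbox 0 1) (\<lambda>h x. incr h j f x / h) g (at_right 0)"
  using diffquot_limit[OF assms, of 0] by simp

lemma torus_cont_bounded: "torus_cont f \<Longrightarrow> bounded (f ` cbox 0 1)"
  by (auto simp: torus_cont_def intro!: compact_imp_bounded compact_continuous_image continuous_on_subset[of UNIV])

lemma cell_int_limit:
  fixes F :: "real \<Rightarrow> real^3 \<Rightarrow> real"
  assumes "uniform_limit (cbox 0 1) F f (at_right 0)" "\<And>h. torus_cont (F h)"
  shows "((\<lambda>h. cell_int (F h)) \<longlongrightarrow> cell_int f) (at_right (0::real))"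
proof -
  obtain I J where IJ: "\<And>h. (F h has_integral I h) (cbox 0 1)" "(f has_integral J) (cbox 0 1)"
    and lim: "(I \<longlongrightarrow> J) (at_right 0)"
    using uniform_limit_integral_cbox[OF assms(1)] assms(2)
    by (metis (no_types, lifting) continuous_on_subset subset_UNIV torus_cont_def trivial_limit_at_right_real)
  have "cell_int (F h) = I h" "cell_int f = J" for h
    using IJ by (auto simp: cell_int_def dest: integral_unique)
  then show ?thesis using lim by simp
qed

lemma uniform_lim_sum:
  fixes f :: "'i \<Rightarrow> 'a \<Rightarrow> 'b \<Rightarrow> 'c::real_normed_vector"
  assumes "\<And>i. i \<in> I \<Longrightarrow> uniform_limit X (f i) (l i) F"
  shows "uniform_limit X (\<lambda>n x. \<Sum>i\<in>I. f i n x) (\<lambda>x. \<Sum>i\<in>I. l i x) F"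
  using assms by (induction I rule: infinite_finite_induct)
    (auto intro: uniform_limit_const uniform_limit_add)

text \<open>
  This is how exact identities for differences become identities for derivatives of functions that
  are merely \<open>C\<^sup>1\<close>.
\<close>

lemma cell_int_limit_zero:
  fixes F :: "real \<Rightarrow> real^3 \<Rightarrow> real"
  assumes "uniform_limit (cbox 0 1) F f (at_right 0)" "\<And>h. torus_cont (F h)"
    and "\<And>h. 0 < h \<Longrightarrow> h \<le> 1 \<Longrightarrow> cell_int (F h) = 0"
  shows "cell_int f = 0"
proof -
  have "\<forall>\<^sub>F h in at_right 0. cell_int (F h) = 0"
    using assms(3) by (intro eventually_at_rightI[of 0 1]) auto
  then have "((\<lambda>h. cell_int (F h)) \<longlongrightarrow> 0) (at_right 0)" by (rule tendsto_eventually)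
  then show ?thesis using cell_int_limit[OF assms(1,2)]
    by (metis tendsto_unique trivial_limit_at_right_real)
qed

lemma cell_int_incr:
  "torus_cont f \<Longrightarrow> 0 \<le> h \<Longrightarrow> h \<le> 1 \<Longrightarrow> cell_int (incr h j f) = 0"
  unfolding incr_def by (simp add: cell_int_arith cell_int_shift)

text \<open>
  The integral of a difference quotient vanishes by translation invariance, and difference quotients
  converge uniformly.
\<close>

lemma cell_int_partial:
  assumes "has_torus_partial j f g"
  shows "cell_int g = 0"
  by (rule cell_int_limit_zero[OF diffquot_limit0[OF assms]])
    (use assms in \<open>auto simp: cell_int_arith cell_int_incr has_torus_partial_def\<close>)

lemma cell_int_by_parts:
  assumes "has_torus_partial j f f'" "has_torus_partial j g g'"
  shows "cell_int (\<lambda>x. f' x * g x) = - cell_int (\<lambda>x. f x * g' x)"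
  using cell_int_partial[OF has_torus_partial_mult[OF assms]] assms
  by (simp add: cell_int_arith has_torus_partial_def)

lemma incr_sum: "incr h j (\<lambda>x. \<Sum>i\<in>I. f i x) x = (\<Sum>i\<in>I. incr h j (f i) x)"
  by (simp add: incr_def sum_subtractf)

section \<open>Exact integral identities for divergence free fields\<close>

text \<open>
  A divergence free \<open>C\<^sup>1\<close> vector field \<open>u\<close> on the torus; \<open>A i j\<close> is the derivative of the component
  \<open>u i\<close> in direction \<open>j\<close>.
\<close>

locale torus_flow =
  fixes u :: "3 \<Rightarrow> real^3 \<Rightarrow> real" and A :: "3 \<Rightarrow> 3 \<Rightarrow> real^3 \<Rightarrow> real"
  assumes partial: "has_torus_partial j (u i) (A i j)"
    and div_free: "(\<Sum>i\<in>UNIV. A i i x) = 0"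
begin

lemma cont [simp, intro]: "torus_cont (u i)" "torus_cont (A i j)"
  using partial has_torus_partial_cont by blast+

lemma cell_int_trace_incr_zero:
  assumes f: "torus_cont f"
  shows "(\<Sum>i\<in>UNIV. cell_int (\<lambda>x. f x * incr h j (A i i) x)) = 0"
proof -
  have "(\<Sum>i\<in>UNIV. cell_int (\<lambda>x. f x * incr h j (A i i) x)) =
     cell_int (\<lambda>x. f x * incr h j (\<lambda>x. \<Sum>i\<in>UNIV. A i i x) x)"
    unfolding incr_sum sum_distrib_left by (subst cell_int_sum) (auto simp: f)
  then show ?thesis by (simp add: div_free incr_def cell_int_arith)
qed

text \<open>
  For smooth \<open>u\<close> one integrates \<open>\<partial>\<^sub>j u\<^sub>i \<partial>\<^sub>i u\<^sub>j\<close> by parts in direction \<open>i\<close> and meets \<open>\<partial>\<^sub>j div u = 0\<close>. With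
  \<open>\<partial>\<^sub>j u\<^sub>i\<close> replaced by an increment of \<open>u\<^sub>i\<close>, which is still \<open>C\<^sup>1\<close>, the same step is exact.
\<close>

lemma cell_int_trace_square: "cell_int (\<lambda>x. \<Sum>i\<in>UNIV. \<Sum>j\<in>UNIV. A i j x * A j i x) = 0"
proof (rule cell_int_limit_zero)
  show "uniform_limit (cbox 0 1) (\<lambda>h x. \<Sum>i\<in>UNIV. \<Sum>j\<in>UNIV. incr h j (u i) x / h * A j i x)
    (\<lambda>x. \<Sum>i\<in>UNIV. \<Sum>j\<in>UNIV. A i j x * A j i x) (at_right 0)"
    by (intro uniform_lim_sum uniform_lim_mult uniform_limit_const diffquot_limit0 partial torus_cont_bounded cont)
  fix h :: real assume h: "0 < h" "h \<le> 1"
  have "cell_int (\<lambda>x. \<Sum>i\<in>UNIV. \<Sum>j\<in>UNIV. incr h j (u i) x / h * A j i x) =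
    (\<Sum>i\<in>UNIV. \<Sum>j\<in>UNIV. cell_int (\<lambda>x. incr h j (u i) x * A j i x) / h)"
    by (simp add: cell_int_sum cell_int_arith)
  also have "\<dots> = (\<Sum>j\<in>UNIV. \<Sum>i\<in>UNIV. cell_int (\<lambda>x. A j i x * incr h j (u i) x) / h)"
    by (subst sum.swap) (simp add: mult.commute)
  also have "\<dots> = (\<Sum>j\<in>UNIV. - (\<Sum>i\<in>UNIV. cell_int (\<lambda>x. u j x * incr h j (A i i) x)) / h)"
    by (subst cell_int_by_parts[OF partial has_torus_partial_incr[OF partial]])
      (simp add: sum_negf sum_divide_distrib)
  finally show "cell_int (\<lambda>x. \<Sum>i\<in>UNIV. \<Sum>j\<in>UNIV. incr h j (u i) x / h * A j i x) = 0"
    by (simp add: cell_int_trace_incr_zero)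
qed auto

text \<open>
  The discrete form of testing the Euler equations with \<open>- \<Delta> u\<close>, where \<open>w\<close> stands for the time
  derivative of \<open>u\<close>. Taking the increment of the equation and pairing it with the increment of \<open>u\<close>,
  the pressure drops out because increments of \<open>u\<close> are divergence free, and so does the part in which
  the increment falls on \<open>A\<close>, since it is transport of \<open>(incr h j (u i))\<^sup>2\<close> by the shifted field. What
  remains contains first derivatives only, so it has a limit without control of second derivatives.
\<close>

lemma cell_int_incr_euler:
  fixes p :: "real^3 \<Rightarrow> real" and P w :: "3 \<Rightarrow> real^3 \<Rightarrow> real"
  assumes p: "\<And>i. has_torus_partial i p (P i)"
    and w: "\<And>i x. w i x + (\<Sum>k\<in>UNIV. u k x * A i k x) = - P i x"
  shows "(\<Sum>i\<in>UNIV. cell_int (\<lambda>x. incr h j (u i) x * incr h j (w i) x)) =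
    - (\<Sum>i\<in>UNIV. \<Sum>k\<in>UNIV. cell_int (\<lambda>x. incr h j (u i) x * incr h j (u k) x * A i k x))"
proof -
  let ?d = "incr h j" and ?e = "h *\<^sub>R axis j 1 :: real^3"
  have [simp, intro]: "torus_cont p" "torus_cont (P i)" for i
    using p has_torus_partial_cont by blast+
  have w': "w i = (\<lambda>x. - P i x - (\<Sum>k\<in>UNIV. u k x * A i k x))" for i
    using w by (auto simp: fun_eq_iff algebra_simps)
  have *: "?d (u i) x * ?d (w i) x = - (?d (u i) x * ?d (P i) x)
     - (\<Sum>k\<in>UNIV. ?d (u i) x * ?d (u k) x * A i k x)
     - (\<Sum>k\<in>UNIV. u k (x + ?e) * (?d (u i) x * ?d (A i k) x))" for i x
  proof -
    have "?d (w i) x = - ?d (P i) x - ?d (\<lambda>x. \<Sum>k\<in>UNIV. u k x * A i k x) x"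
      unfolding w' by (simp add: incr_def)
    also have "?d (\<lambda>x. \<Sum>k\<in>UNIV. u k x * A i k x) x =
        (\<Sum>k\<in>UNIV. ?d (u k) x * A i k x) + (\<Sum>k\<in>UNIV. u k (x + ?e) * ?d (A i k) x)"
      by (simp add: incr_def sum_subtractf[symmetric] sum.distrib[symmetric] algebra_simps)
    finally have d: "?d (w i) x = - ?d (P i) x - ((\<Sum>k\<in>UNIV. ?d (u k) x * A i k x)
        + (\<Sum>k\<in>UNIV. u k (x + ?e) * ?d (A i k) x))" .
    show ?thesis
      unfolding d by (simp add: algebra_simps sum_distrib_left)
  qed
  have expand: "(\<Sum>i\<in>UNIV. cell_int (\<lambda>x. ?d (u i) x * ?d (w i) x)) = - (\<Sum>i\<in>UNIV. cell_int (\<lambda>x. ?d (u i) x * ?d (P i) x))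
    - (\<Sum>i\<in>UNIV. \<Sum>k\<in>UNIV. cell_int (\<lambda>x. ?d (u i) x * ?d (u k) x * A i k x))
    - (\<Sum>i\<in>UNIV. \<Sum>k\<in>UNIV. cell_int (\<lambda>x. u k (x + ?e) * (?d (u i) x * ?d (A i k) x)))"
    unfolding * by (simp add: cell_int_sum cell_int_arith sum_subtractf sum_negf)
  have pressure: "(\<Sum>i\<in>UNIV. cell_int (\<lambda>x. ?d (u i) x * ?d (P i) x)) = 0"
  proof -
    have "cell_int (\<lambda>x. ?d (u i) x * ?d (P i) x) = - cell_int (\<lambda>x. ?d p x * ?d (A i i) x)" for i
      using cell_int_by_parts[OF has_torus_partial_incr[OF p[of i], where h = h and j = j] has_torus_partial_incr[OF partial[of i i], where h = h and j = j]]
      by (simp add: mult.commute)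
    then show ?thesis by (simp add: sum_negf cell_int_trace_incr_zero)
  qed
  have transport: "(\<Sum>k\<in>UNIV. cell_int (\<lambda>x. u k (x + ?e) * (?d (u i) x * ?d (A i k) x))) = 0" for i
  proof -
    have "2 * cell_int (\<lambda>x. u k (x + ?e) * (?d (u i) x * ?d (A i k) x)) =
      - cell_int (\<lambda>x. A k k (x + ?e) * (?d (u i) x * ?d (u i) x))" for k
    proof -
      have 1: "has_torus_partial k (?d (u i)) (?d (A i k))"
        by (intro has_torus_partial_incr partial)
      show ?thesis
        using cell_int_by_parts[OF has_torus_partial_shift[OF partial, of k k ?e] has_torus_partial_mult[OF 1 1]]
        by (simp add: algebra_simps cell_int_arith)
    qed
    then have "2 * (\<Sum>k\<in>UNIV. cell_int (\<lambda>x. u k (x + ?e) * (?d (u i) x * ?d (A i k) x))) =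
      - (\<Sum>k\<in>UNIV. cell_int (\<lambda>x. A k k (x + ?e) * (?d (u i) x * ?d (u i) x)))"
      by (simp add: sum_distrib_left sum_negf)
    also have "(\<Sum>k\<in>UNIV. cell_int (\<lambda>x. A k k (x + ?e) * (?d (u i) x * ?d (u i) x))) =
       cell_int (\<lambda>x. (\<Sum>k\<in>UNIV. A k k (x + ?e)) * (?d (u i) x * ?d (u i) x))"
      unfolding sum_distrib_right by (subst cell_int_sum) auto
    finally show ?thesis by (simp add: div_free cell_int_arith)
  qed
  show ?thesis using expand pressure transport by simp
qed

end

text \<open>
  The Jacobian determinant is a null Lagrangian. For smooth fields it is a divergence because mixed
  second derivatives cancel. Here the wedge product of gradients is replaced by the cup product of
  discrete differentials, in which each factor is evaluated at the end point of the preceding edge.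
  The discrete determinant \<open>F\<close> is then exactly a sum of increments, so that its integral is zero, and
  \<open>F / h\<^sup>3\<close> converges to the determinant.
\<close>

lemma cell_int_det_grad:
  assumes partial: "\<And>i j. has_torus_partial j (u i) (A i j)"
  shows "cell_int (\<lambda>x. det (\<chi> i j. A i j x)) = 0"
proof -
  define E where "E h i j k x = incr h i (u 1) x * incr h j (u 2) (x + h *\<^sub>R axis i 1)
     * incr h k (u 3) (x + h *\<^sub>R (axis i 1 + axis j 1))" for h i j k and x :: "real^3"
  define F where "F h x = E h 1 2 3 x + E h 2 3 1 x + E h 3 1 2 x
     - E h 1 3 2 x - E h 2 1 3 x - E h 3 2 1 x" for h x
  have [simp, intro]: "torus_cont (u i)" "torus_cont (A i j)" for i j
    using partial has_torus_partial_cont by blast+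
  have E_lim: "uniform_limit (cbox 0 1) (\<lambda>h x. incr h i (u 1) x / h * (incr h j (u 2) (x + h *\<^sub>R axis i 1) / h)
     * (incr h k (u 3) (x + h *\<^sub>R (axis i 1 + axis j 1)) / h)) (\<lambda>x. A 1 i x * A 2 j x * A 3 k x) (at_right 0)" for i j k
    by (intro uniform_lim_mult diffquot_limit0 diffquot_limit partial torus_cont_bounded torus_cont_arith) auto
  then have E_lim: "uniform_limit (cbox 0 1) (\<lambda>h x. E h i j k x / h ^ 3) (\<lambda>x. A 1 i x * A 2 j x * A 3 k x) (at_right 0)" for i j k
    by (simp add: E_def power3_eq_cube)
  have E_cont: "torus_cont (E h i j k)" for h i j k
    unfolding E_def by auto
  have F_lim: "uniform_limit (cbox 0 1) (\<lambda>h x. F h x / h ^ 3) (\<lambda>x. det (\<chi> i j. A i j x)) (at_right 0)"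
    unfolding F_def add_divide_distrib diff_divide_distrib
    by (rule uniform_limit_cong'[THEN iffD1, OF _ _ uniform_limit_minus[OF uniform_limit_minus[OF uniform_limit_minus[OF
        uniform_limit_add[OF uniform_limit_add[OF E_lim E_lim] E_lim] E_lim] E_lim] E_lim]])
      (simp_all add: det_3)
  show ?thesis
  proof (rule cell_int_limit_zero[OF F_lim])
    show "torus_cont (\<lambda>x. F h x / h ^ 3)" for h unfolding F_def using E_cont by auto
    fix h :: real assume h: "0 < h" "h \<le> 1"
    \<comment> \<open>\<open>X j k - X k j\<close> are the components of the cup product of the differentials of \<open>u 2\<close> and \<open>u 3\<close>;
    this product is closed, hence multiplying it by \<open>u 1\<close> gives a primitive of \<open>F\<close>.\<close>
    define X where "X j k x = incr h j (u 2) x * incr h k (u 3) (x + h *\<^sub>R axis j 1)" for j k and x :: "real^3"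
    define Y where "Y j k x = u 1 x * (X j k x - X k j x)" for j k x
    have Y_cont: "torus_cont (Y j k)" for j k
      unfolding Y_def X_def by auto
    have "F h = (\<lambda>x. incr h 1 (Y 2 3) x + incr h 2 (Y 3 1) x + incr h 3 (Y 1 2) x)"
      unfolding F_def E_def Y_def X_def incr_def
      by (simp add: fun_eq_iff scaleR_add_right ac_simps) (simp add: algebra_simps)
    then have "cell_int (F h) = 0"
      using h Y_cont by (simp add: cell_int_arith cell_int_incr)
    then show "cell_int (\<lambda>x. F h x / h ^ 3) = 0" by (simp add: cell_int_arith)
  qed
qed

section \<open>Evolution of the enstrophy\<close>

lemma measure_unit_cell: "measure lborel (cbox 0 (1::real^3)) = 1"
proof -
  have "(0::real^3) \<in> cbox 0 1" by (simp add: mem_box_cart)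
  then have "cbox 0 (1::real^3) \<noteq> {}" by blast
  then show ?thesis by (simp add: content_cbox_cart)
qed

lemma cell_int_uniform_limit:
  fixes F :: "real \<Rightarrow> 'p \<Rightarrow> real^3 \<Rightarrow> real"
  assumes lim: "uniform_limit (K \<times> cbox 0 1) (\<lambda>h z. F h (fst z) (snd z)) (\<lambda>z. f (fst z) (snd z)) (at_right 0)"
    and F: "\<And>h t. t \<in> K \<Longrightarrow> torus_cont (F h t)" and f: "\<And>t. t \<in> K \<Longrightarrow> torus_cont (f t)"
  shows "uniform_limit K (\<lambda>h t. cell_int (F h t)) (\<lambda>t. cell_int (f t)) (at_right 0)"
proof (rule uniform_limitI)
  fix e :: real assume e: "e > 0"
  have "\<forall>\<^sub>F h in at_right 0. \<forall>z\<in>K \<times> cbox 0 1. dist (F h (fst z) (snd z)) (f (fst z) (snd z)) < e / 2"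
    using uniform_limitD[OF lim, of "e / 2"] e by simp
  then show "\<forall>\<^sub>F h in at_right 0. \<forall>t\<in>K. dist (cell_int (F h t)) (cell_int (f t)) < e"
  proof eventually_elim
    case (elim h)
    show ?case
    proof
      fix t assume t: "t \<in> K"
      have "norm (cell_int (\<lambda>x. F h t x - f t x)) \<le> e / 2 * measure lborel (cbox 0 (1::real^3))"
        unfolding cell_int_def
        by (rule integrable_bound) (use elim e t F f in \<open>force simp: dist_norm less_imp_le\<close>)+
      then show "dist (cell_int (F h t)) (cell_int (f t)) < e"
        using e F[OF t] f[OF t] by (simp add: cell_int_arith dist_norm measure_unit_cell)
    qed
  qed
qed

lemma continuous_on_cell_int:
  assumes "continuous_on (U \<times> UNIV) (\<lambda>z. f (fst z) (snd z))"
  shows "continuous_on U (\<lambda>t. cell_int (f t))"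
  unfolding cell_int_def
  using continuous_on_subset[OF assms, of "U \<times> cbox 0 1"]
  by (intro integral_continuous_on_param) (auto simp: case_prod_unfold)

lemma continuous_on_incr:
  assumes "continuous_on (U \<times> UNIV) (\<lambda>z. f (fst z) (snd z))"
  shows "continuous_on (U \<times> UNIV) (\<lambda>z. incr h j (f (fst z)) (snd z))"
proof -
  let ?s = "\<lambda>z. (fst z, snd z + h *\<^sub>R (axis j 1 :: real^3))"
  have "continuous_on (U \<times> UNIV) ?s" by (intro continuous_intros)
  moreover have "?s ` (U \<times> UNIV) \<subseteq> U \<times> UNIV" by auto
  ultimately have "continuous_on (U \<times> UNIV) (\<lambda>z. f (fst (?s z)) (snd (?s z)))"
    by (rule continuous_on_compose2[OF assms])
  then have "continuous_on (U \<times> UNIV) (\<lambda>z. f (fst z) (snd z + h *\<^sub>R axis j 1))"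
    by (simp only: fst_conv snd_conv)
  then show ?thesis
    unfolding incr_def by (intro continuous_on_diff assms)
qed

lemma cell_int_has_derivative:
  fixes f :: "real \<Rightarrow> real^3 \<Rightarrow> real"
  assumes U: "open U" "convex U" "t \<in> U"
    and d: "\<And>s x. s \<in> U \<Longrightarrow> ((\<lambda>s. f s x) has_real_derivative f' s x) (at s)"
    and f: "\<And>s. s \<in> U \<Longrightarrow> torus_cont (f s)"
    and c: "continuous_on (U \<times> UNIV) (\<lambda>z. f' (fst z) (snd z))"
  shows "((\<lambda>s. cell_int (f s)) has_real_derivative cell_int (f' t)) (at t)"
proof -
  have "((\<lambda>s. integral (cbox 0 1) (f s)) has_real_derivative integral (cbox 0 1) (f' t)) (at t within U)"
  proof (rule leibniz_rule_field_derivative[OF _ _ _ U(3,2)])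
    show "continuous_on (U \<times> cbox 0 1) (\<lambda>(s, x). f' s x)"
      using continuous_on_subset[OF c, of "U \<times> cbox 0 1"] by (auto simp: case_prod_unfold)
  qed (use d f in \<open>auto intro: has_field_derivative_at_within\<close>)
  then show ?thesis by (simp only: cell_int_def at_within_open[OF U(3,1)])
qed

text \<open>
  The Euler equations in components: \<open>W\<close> is the time derivative of the velocity \<open>v\<close>, \<open>A t i j\<close> the
  derivative of the component \<open>v t i\<close> in direction \<open>j\<close>, and \<open>P\<close> the gradient of the pressure \<open>p\<close>.
\<close>

locale euler_flow =
  fixes T :: real and v W P :: "real \<Rightarrow> 3 \<Rightarrow> real^3 \<Rightarrow> real" and A :: "real \<Rightarrow> 3 \<Rightarrow> 3 \<Rightarrow> real^3 \<Rightarrow> real"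
    and p :: "real \<Rightarrow> real^3 \<Rightarrow> real"
  assumes flow: "t \<in> {0<..<T} \<Longrightarrow> torus_flow (v t) (A t)"
    and pressure: "t \<in> {0<..<T} \<Longrightarrow> has_torus_partial i (p t) (P t i)"
    and euler: "t \<in> {0<..<T} \<Longrightarrow> W t i x + (\<Sum>k\<in>UNIV. v t k x * A t i k x) = - P t i x"
    and time_deriv: "t \<in> {0<..<T} \<Longrightarrow> ((\<lambda>s. v s i x) has_real_derivative W t i x) (at t)"
    and cont_v: "continuous_on ({0<..<T} \<times> UNIV) (\<lambda>z. v (fst z) i (snd z))"
    and cont_A: "continuous_on ({0<..<T} \<times> UNIV) (\<lambda>z. A (fst z) i j (snd z))"
    and cont_W: "continuous_on ({0<..<T} \<times> UNIV) (\<lambda>z. W (fst z) i (snd z))"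
begin

text \<open>
  The squared \<open>L\<^sup>2\<close> norm of the full velocity gradient, which for divergence free fields equals the
  squared \<open>L\<^sup>2\<close> norm of the vorticity.
\<close>

definition enstrophy :: "real \<Rightarrow> real"
  where "enstrophy t = cell_int (\<lambda>x. \<Sum>j\<in>UNIV. \<Sum>i\<in>UNIV. A t i j x * A t i j x)"

definition growth :: "real \<Rightarrow> real"
  where "growth t = - 2 * cell_int (\<lambda>x. \<Sum>j\<in>UNIV. \<Sum>i\<in>UNIV. \<Sum>k\<in>UNIV. A t i j x * A t k j x * A t i k x)"

definition enstrophy_diff :: "real \<Rightarrow> real \<Rightarrow> real"
  where "enstrophy_diff h t = cell_int (\<lambda>x. \<Sum>j\<in>UNIV. \<Sum>i\<in>UNIV. incr h j (v t i) x / h * (incr h j (v t i) x / h))"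

definition growth_diff :: "real \<Rightarrow> real \<Rightarrow> real"
  where "growth_diff h t = - 2 * cell_int (\<lambda>x. \<Sum>j\<in>UNIV. \<Sum>i\<in>UNIV. \<Sum>k\<in>UNIV.
     incr h j (v t i) x / h * (incr h j (v t k) x / h) * A t i k x)"

lemma cont [simp, intro]:
  assumes "t \<in> {0<..<T}"
  shows "torus_cont (v t i)" "torus_cont (A t i j)" "torus_cont (W t i)"
proof -
  interpret torus_flow "v t" "A t" by (rule flow[OF assms])
  show 1: "torus_cont (v t i)" "torus_cont (A t i j)" for i j by auto
  have "W t i = (\<lambda>x. - P t i x - (\<Sum>k\<in>UNIV. v t k x * A t i k x))"
    using euler[OF assms, of i] by (auto simp: fun_eq_iff algebra_simps)
  moreover have "torus_cont (P t i)" using pressure[OF assms, of i] by (rule has_torus_partial_cont)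
  ultimately show "torus_cont (W t i)" using 1 by auto
qed

lemma enstrophy_diff_derivative:
  assumes t: "t \<in> {0<..<T}"
  shows "(enstrophy_diff h has_real_derivative growth_diff h t) (at t)"
proof -
  interpret torus_flow "v t" "A t" by (rule flow[OF t])
  let ?d = "\<lambda>t j i. incr h j (v t i)" and ?dW = "\<lambda>t j i. incr h j (W t i)"
  have "(enstrophy_diff h has_real_derivative cell_int (\<lambda>x. \<Sum>j\<in>UNIV. \<Sum>i\<in>UNIV.
     2 * (?d t j i x / h * (?dW t j i x / h)))) (at t)"
    unfolding enstrophy_diff_def
  proof (rule cell_int_has_derivative[OF _ _ t])
    fix s x assume s: "s \<in> {0<..<T}"
    have d: "((\<lambda>s. ?d s j i x / h) has_real_derivative ?dW s j i x / h) (at s)" for i j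
      unfolding incr_def by (intro DERIV_cdivide derivative_intros time_deriv s)
    show "((\<lambda>s. \<Sum>j\<in>UNIV. \<Sum>i\<in>UNIV. ?d s j i x / h * (?d s j i x / h)) has_real_derivative
      (\<Sum>j\<in>UNIV. \<Sum>i\<in>UNIV. 2 * (?d s j i x / h * (?dW s j i x / h)))) (at s)"
      by (rule DERIV_cong[OF DERIV_sum[OF DERIV_sum[OF DERIV_mult[OF d d]]]]) (simp add: mult.commute)
  next
    show "continuous_on ({0<..<T} \<times> UNIV) (\<lambda>z. \<Sum>j\<in>UNIV. \<Sum>i\<in>UNIV.
       2 * (?d (fst z) j i (snd z) / h * (?dW (fst z) j i (snd z) / h)))"
      unfolding divide_inverse by (intro continuous_intros continuous_on_incr cont_v cont_W)
  qed auto
  moreover have "cell_int (\<lambda>x. \<Sum>j\<in>UNIV. \<Sum>i\<in>UNIV. 2 * (?d t j i x / h * (?dW t j i x / h))) = growth_diff h t"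
  proof -
    have "(\<lambda>x. \<Sum>j\<in>UNIV. \<Sum>i\<in>UNIV. 2 * (?d t j i x / h * (?dW t j i x / h))) =
       (\<lambda>x. \<Sum>j\<in>UNIV. 2 / h\<^sup>2 * (\<Sum>i\<in>UNIV. ?d t j i x * ?dW t j i x))"
      by (intro ext sum.cong refl) (simp add: sum_distrib_left power2_eq_square)
    then have "cell_int (\<lambda>x. \<Sum>j\<in>UNIV. \<Sum>i\<in>UNIV. 2 * (?d t j i x / h * (?dW t j i x / h))) =
       (\<Sum>j\<in>UNIV. 2 / h\<^sup>2 * (\<Sum>i\<in>UNIV. cell_int (\<lambda>x. ?d t j i x * ?dW t j i x)))"
      using t by (simp add: cell_int_sum cell_int_arith)
    also have "\<dots> = (\<Sum>j\<in>UNIV. 2 / h\<^sup>2 * - (\<Sum>i\<in>UNIV. \<Sum>k\<in>UNIV. cell_int (\<lambda>x. ?d t j i x * ?d t j k x * A t i k x)))"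
      by (simp only: cell_int_incr_euler[where p = "p t" and P = "P t", OF pressure[OF t] euler[OF t]])
    also have "\<dots> = - 2 * (\<Sum>j\<in>UNIV. 1 / h\<^sup>2 * (\<Sum>i\<in>UNIV. \<Sum>k\<in>UNIV. cell_int (\<lambda>x. ?d t j i x * ?d t j k x * A t i k x)))"
      by (simp add: sum_distrib_left sum_negf)
    also have "\<dots> = - 2 * cell_int (\<lambda>x. \<Sum>j\<in>UNIV. 1 / h\<^sup>2 * (\<Sum>i\<in>UNIV. \<Sum>k\<in>UNIV. ?d t j i x * ?d t j k x * A t i k x))"
      using t by (simp add: cell_int_sum cell_int_arith)
    also have "(\<lambda>x. \<Sum>j\<in>UNIV. 1 / h\<^sup>2 * (\<Sum>i\<in>UNIV. \<Sum>k\<in>UNIV. ?d t j i x * ?d t j k x * A t i k x)) =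
       (\<lambda>x. \<Sum>j\<in>UNIV. \<Sum>i\<in>UNIV. \<Sum>k\<in>UNIV. ?d t j i x / h * (?d t j k x / h) * A t i k x)"
      by (intro ext sum.cong refl) (simp add: sum_distrib_left power2_eq_square)
    finally show ?thesis by (simp only: growth_diff_def)
  qed
  ultimately show ?thesis by simp
qed

lemma diff_limits:
  assumes K: "K \<subseteq> {0<..<T}" "compact K"
  shows "uniform_limit K enstrophy_diff enstrophy (at_right 0)"
    and "uniform_limit K growth_diff growth (at_right 0)"
proof -
  have K': "t \<in> {0<..<T}" if "t \<in> K" for t using K that by auto
  have cA: "continuous_on (K \<times> UNIV) (\<lambda>z. A (fst z) i j (snd z))" for i j
    by (rule continuous_on_subset[OF cont_A]) (use K in auto)
  have D: "uniform_limit (K \<times> cbox 0 1) (\<lambda>h z. incr h j (v (fst z) i) (snd z) / h)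
     (\<lambda>z. A (fst z) i j (snd z)) (at_right 0)" for i j
    using diffquot_uniform_limit[of K "\<lambda>t. A t i j" "\<lambda>t. v t i" "axis j 1" 0] K' cA torus_flow.partial[OF flow]
    unfolding has_torus_partial_def by (simp add: case_prod_unfold incr_def K)
  have bdd: "bounded ((\<lambda>z. A (fst z) i j (snd z)) ` (K \<times> cbox 0 1))" for i j
    by (intro compact_imp_bounded compact_continuous_image compact_Times K compact_cbox
        continuous_on_subset[OF cA]) auto
  have bdd2: "bounded ((\<lambda>z. A (fst z) i j (snd z) * A (fst z) i' j' (snd z)) ` (K \<times> cbox 0 1))" for i j i' j'
    by (intro compact_imp_bounded compact_continuous_image compact_Times K compact_cbox
        continuous_on_subset[OF continuous_on_mult[OF cA cA]]) auto
  show "uniform_limit K enstrophy_diff enstrophy (at_right 0)"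
    unfolding enstrophy_diff_def enstrophy_def
  proof (rule cell_int_uniform_limit)
    show "uniform_limit (K \<times> cbox 0 1)
      (\<lambda>h z. \<Sum>j\<in>UNIV. \<Sum>i\<in>UNIV. incr h j (v (fst z) i) (snd z) / h * (incr h j (v (fst z) i) (snd z) / h))
      (\<lambda>z. \<Sum>j\<in>UNIV. \<Sum>i\<in>UNIV. A (fst z) i j (snd z) * A (fst z) i j (snd z)) (at_right 0)"
      by (intro uniform_lim_sum uniform_lim_mult D bdd)
  qed (use K' in simp_all)
  have "uniform_limit K (\<lambda>h t. cell_int (\<lambda>x. \<Sum>j\<in>UNIV. \<Sum>i\<in>UNIV. \<Sum>k\<in>UNIV.
     incr h j (v t i) x / h * (incr h j (v t k) x / h) * A t i k x))
     (\<lambda>t. cell_int (\<lambda>x. \<Sum>j\<in>UNIV. \<Sum>i\<in>UNIV. \<Sum>k\<in>UNIV. A t i j x * A t k j x * A t i k x)) (at_right 0)"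
  proof (rule cell_int_uniform_limit)
    show "uniform_limit (K \<times> cbox 0 1)
      (\<lambda>h z. \<Sum>j\<in>UNIV. \<Sum>i\<in>UNIV. \<Sum>k\<in>UNIV. incr h j (v (fst z) i) (snd z) / h *
         (incr h j (v (fst z) k) (snd z) / h) * A (fst z) i k (snd z))
      (\<lambda>z. \<Sum>j\<in>UNIV. \<Sum>i\<in>UNIV. \<Sum>k\<in>UNIV. A (fst z) i j (snd z) * A (fst z) k j (snd z)
         * A (fst z) i k (snd z)) (at_right 0)"
      by (intro uniform_lim_sum uniform_lim_mult D bdd bdd2 uniform_limit_const)
  qed (use K' in simp_all)
  from bounded_linear.uniform_limit[OF bounded_linear_mult_right[of "-2"] this]
  show "uniform_limit K growth_diff growth (at_right 0)"
    unfolding growth_diff_def growth_def by simp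
qed

lemma continuous_on_growth: "continuous_on {0<..<T} growth"
proof -
  have "continuous_on ({0<..<T} \<times> UNIV) (\<lambda>z. \<Sum>j\<in>UNIV. \<Sum>i\<in>UNIV. \<Sum>k\<in>UNIV.
     A (fst z) i j (snd z) * A (fst z) k j (snd z) * A (fst z) i k (snd z))"
    by (intro continuous_intros cont_A)
  from continuous_on_cell_int[OF this] show ?thesis
    unfolding growth_def by (intro continuous_on_mult continuous_on_const)
qed

lemma continuous_on_growth_diff: "continuous_on {0<..<T} (growth_diff h)"
proof -
  have "continuous_on ({0<..<T} \<times> UNIV) (\<lambda>z. \<Sum>j\<in>UNIV. \<Sum>i\<in>UNIV. \<Sum>k\<in>UNIV.
     incr h j (v (fst z) i) (snd z) / h * (incr h j (v (fst z) k) (snd z) / h) * A (fst z) i k (snd z))"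
    unfolding divide_inverse by (intro continuous_intros continuous_on_incr cont_A cont_v)
  from continuous_on_cell_int[OF this] show ?thesis
    unfolding growth_diff_def by (intro continuous_on_mult continuous_on_const)
qed

text \<open>
  The difference analogue of the enstrophy balance is exact, so it can be integrated in time; both
  sides converge uniformly on compact time intervals. Differentiating the limit directly would
  require second derivatives of \<open>v\<close>.
\<close>

lemma enstrophy_integral:
  assumes ab: "0 < a" "a \<le> b" "b < T"
  shows "enstrophy b - enstrophy a = integral {a..b} growth"
proof -
  have K: "{a..b} \<subseteq> {0<..<T}" using ab by auto
  note lim = diff_limits[OF K compact_Icc]
  have I: "(growth_diff h has_integral enstrophy_diff h b - enstrophy_diff h a) {a..b}" for h
  proof (rule fundamental_theorem_of_calculus[OF ab(2)])
    fix s assume "s \<in> {a..b}"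
    then have "(enstrophy_diff h has_real_derivative growth_diff h s) (at s)"
      using K by (intro enstrophy_diff_derivative) blast
    then show "(enstrophy_diff h has_vector_derivative growth_diff h s) (at s within {a..b})"
      unfolding has_real_derivative_iff_has_vector_derivative by (rule has_vector_derivative_at_within)
  qed
  obtain I J where IJ: "\<And>h. (growth_diff h has_integral I h) {a..b}" "(growth has_integral J) {a..b}" "(I \<longlongrightarrow> J) (at_right 0)"
    by (rule uniform_limit_integral[OF lim(2) continuous_on_subset[OF continuous_on_growth_diff K]]) auto
  have Ieq: "I = (\<lambda>h. enstrophy_diff h b - enstrophy_diff h a)"
    by (rule ext) (rule has_integral_unique[OF IJ(1) I])
  have "((\<lambda>h. enstrophy_diff h b - enstrophy_diff h a) \<longlongrightarrow> J) (at_right 0)"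
    using IJ(3) unfolding Ieq .
  moreover have "a \<in> {a..b}" "b \<in> {a..b}" using ab by auto
  then have "((\<lambda>h. enstrophy_diff h b - enstrophy_diff h a) \<longlongrightarrow> enstrophy b - enstrophy a) (at_right 0)"
    by (intro tendsto_diff tendsto_uniform_limitI[OF lim(1)])
  ultimately have "enstrophy b - enstrophy a = J"
    using tendsto_unique[OF trivial_limit_at_right_real] by blast
  also have "J = integral {a..b} growth"
    by (rule integral_unique[OF IJ(2), symmetric])
  finally show ?thesis .
qed

lemma enstrophy_derivative:
  assumes t: "t \<in> {0<..<T}"
  shows "(enstrophy has_real_derivative growth t) (at t)"
proof -
  define a b where "a = t / 2" and "b = (t + T) / 2"
  have ab: "0 < a" "a < t" "t < b" "b < T" using t by (auto simp: a_def b_def)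
  have "continuous_on {a..b} growth"
    by (rule continuous_on_subset[OF continuous_on_growth]) (use ab in auto)
  then have "((\<lambda>s. integral {a..s} growth) has_real_derivative growth t) (at t within {a..b})"
    using ab by (intro integral_has_real_derivative) auto
  then have "((\<lambda>s. enstrophy a + integral {a..s} growth) has_real_derivative 0 + growth t) (at t within {a..b})"
    by (rule DERIV_add[OF DERIV_const])
  then have "((\<lambda>s. enstrophy a + integral {a..s} growth) has_real_derivative growth t) (at t)"
    using ab by (simp add: at_within_Icc_at)
  then show ?thesis
  proof (rule has_field_derivative_transform_within_open[of _ _ _ "{a<..<b}"])
    fix s assume "s \<in> {a<..<b}"
    then show "enstrophy a + integral {a..s} growth = enstrophy s"
      using enstrophy_integral[of a s] ab by simp
  qed (use ab in auto)
qed

end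

section \<open>The middle eigenvalue controls the growth\<close>

text \<open>
  For a trace free matrix \<open>a\<close> with symmetric part \<open>S\<close> one has \<open>tr S\<^sup>3 = tr a\<^sup>3 / 4 + 3 tr (a\<^sup>2 a\<^sup>T) / 4\<close>,
  and \<open>tr M\<^sup>3 = 3 det M\<close> for every trace free \<open>M\<close>; the left hand side below is \<open>tr (a\<^sup>2 a\<^sup>T)\<close>.
\<close>

lemma square_grad_det_identity:
  fixes a :: "3 \<Rightarrow> 3 \<Rightarrow> real"
  assumes "(\<Sum>i\<in>UNIV. a i i) = 0"
  shows "(\<Sum>j\<in>UNIV. \<Sum>i\<in>UNIV. \<Sum>k\<in>UNIV. a i j * a k j * a i k) =
    4 * det (\<chi> i j. (a j i + a i j) / 2) - det (\<chi> i j. a i j)"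
proof -
  have a33: "a 3 3 = - a 1 1 - a 2 2" using assms by (simp add: sum_3)
  show ?thesis unfolding sum_3 det_3 vec_lambda_beta a33 by (simp add: field_simps)
qed

text \<open>
  The eigenvalues \<open>a \<ge> b \<ge> c\<close> add up to zero. If \<open>b \<le> 0\<close>, then two of them are nonpositive and the
  determinant \<open>a b c\<close> is nonnegative. Otherwise \<open>- 2 a c \<le> a\<^sup>2 + c\<^sup>2\<close>, which is multiplied by \<open>b\<close>.
\<close>

lemma det_bound_middle_eigenvalue:
  fixes S :: "real^3^3"
  assumes eig: "ordered_eigenvalues S a b c"
    and sym: "\<And>i j. S $ i $ j = S $ j $ i" and tr: "(\<Sum>i\<in>UNIV. S $ i $ i) = 0"
  shows "- 2 * det S \<le> max b 0 * (\<Sum>i\<in>UNIV. \<Sum>j\<in>UNIV. (S $ i $ j)\<^sup>2)"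
proof -
  have char: "det (mat z - S) = (z - a) * (z - b) * (z - c)" and ord: "a \<ge> b" "b \<ge> c" for z
    using eig by (auto simp: ordered_eigenvalues_def)
  have sym': "S $ 2 $ 1 = S $ 1 $ 2" "S $ 3 $ 1 = S $ 1 $ 3" "S $ 3 $ 2 = S $ 2 $ 3"
    by (rule sym)+
  have tr': "S $ 3 $ 3 = - S $ 1 $ 1 - S $ 2 $ 2" using tr by (simp add: sum_3)
  note char' = char[unfolded det_3, simplified mat_def, simplified, unfolded sym' tr']
  have det: "det S = a * b * c"
    using char'[of 0] unfolding det_3 sym' tr' by (simp add: algebra_simps)
  \<comment> \<open>Comparing the characteristic polynomial at \<open>0\<close>, \<open>1\<close> and \<open>-1\<close> yields all symmetric functions of
  the eigenvalues; their squares then add up to \<open>tr S\<^sup>2\<close>.\<close>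
  have sum0: "a + b + c = 0"
    using char'[of 1] char'[of "-1"] char'[of 0] by (simp add: algebra_simps)
  have sq: "(\<Sum>i\<in>UNIV. \<Sum>j\<in>UNIV. (S $ i $ j)\<^sup>2) = a\<^sup>2 + b\<^sup>2 + c\<^sup>2"
  proof -
    have e2: "a * b + b * c + c * a = - (S $ 1 $ 1)\<^sup>2 - (S $ 2 $ 2)\<^sup>2 - S $ 1 $ 1 * S $ 2 $ 2
       - (S $ 1 $ 2)\<^sup>2 - (S $ 1 $ 3)\<^sup>2 - (S $ 2 $ 3)\<^sup>2"
      using char'[of 1] char'[of "-1"] by (simp add: algebra_simps power2_eq_square)
    have "a\<^sup>2 + b\<^sup>2 + c\<^sup>2 = (a + b + c)\<^sup>2 - 2 * (a * b + b * c + c * a)" by algebra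
    then show ?thesis unfolding sum0 e2
      by (simp add: sum_3 sym' tr' power2_eq_square algebra_simps)
  qed
  have "- 2 * (a * b * c) \<le> max b 0 * (a\<^sup>2 + b\<^sup>2 + c\<^sup>2)"
  proof (cases "b \<le> 0")
    case True
    then have "a \<ge> 0" "b * c \<ge> 0" using sum0 ord by (auto simp: mult_nonpos_nonpos)
    then have "0 \<le> a * (b * c)" by simp
    then show ?thesis using True by (simp add: mult.assoc)
  next
    case False
    have "- 2 * (a * c) \<le> a\<^sup>2 + b\<^sup>2 + c\<^sup>2"
    proof -
      have "a\<^sup>2 + b\<^sup>2 + c\<^sup>2 + 2 * (a * c) = (a + c)\<^sup>2 + b\<^sup>2"
        by (simp add: power2_sum)
      moreover have "0 \<le> (a + c)\<^sup>2 + b\<^sup>2" by simp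
      ultimately show ?thesis by linarith
    qed
    then have "b * (- 2 * (a * c)) \<le> b * (a\<^sup>2 + b\<^sup>2 + c\<^sup>2)"
      using False by (intro mult_left_mono) auto
    then show ?thesis using False by (simp add: algebra_simps)
  qed
  then show ?thesis using det sq by simp
qed

lemma cell_int_eq_lebesgue:
  assumes "torus_cont f"
  shows "integrable torus f" "cell_int f = (LINT x|torus. f x)"
proof -
  show i: "integrable torus f"
    using assms by (auto simp: torus_cont_def intro!: continuous_imp_integrable continuous_on_subset[of UNIV f])
  show "cell_int f = (LINT x|torus. f x)"
    unfolding cell_int_def by (rule lebesgue_integral_eq_integral[OF i, symmetric]) simp
qed

lemma cell_int_mono_AE:
  assumes "torus_cont f" "torus_cont g" "AE x in torus. f x \<le> g x"
  shows "cell_int f \<le> cell_int g"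
  using assms by (auto simp: cell_int_eq_lebesgue intro!: integral_mono_AE)

lemma torus_cont_det:
  fixes A :: "3 \<Rightarrow> 3 \<Rightarrow> real^3 \<Rightarrow> real"
  assumes "\<And>i j. torus_cont (A i j)"
  shows "torus_cont (\<lambda>x. det (\<chi> i j. A i j x))"
  unfolding det_3 by (simp add: assms)

context torus_flow begin

text \<open>
  By the pointwise identity and the null Lagrangian \<open>det A\<close>, the growth is \<open>- 8\<close> times the integral of
  the determinant of the strain. The strain carries half of the enstrophy because \<open>tr A\<^sup>2\<close> integrates
  to zero.
\<close>

lemma growth_bound:
  assumes eig: "\<And>x. ordered_eigenvalues (\<chi> i j. (A j i x + A i j x) / 2) (l1 x) (l2 x) (l3 x)"
    and c: "0 \<le> c" and bound: "AE x in torus. max (l2 x) 0 \<le> c"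
  shows "- 2 * cell_int (\<lambda>x. \<Sum>j\<in>UNIV. \<Sum>i\<in>UNIV. \<Sum>k\<in>UNIV. A i j x * A k j x * A i k x)
     \<le> 2 * c * cell_int (\<lambda>x. \<Sum>j\<in>UNIV. \<Sum>i\<in>UNIV. A i j x * A i j x)"
proof -
  let ?S = "\<lambda>x. (\<chi> i j. (A j i x + A i j x) / 2) :: real^3^3"
  let ?Q = "\<lambda>x. \<Sum>i\<in>UNIV. \<Sum>j\<in>UNIV. ((A j i x + A i j x) / 2)\<^sup>2"
  have [simp]: "torus_cont (\<lambda>x. det (?S x))" "torus_cont (\<lambda>x. det (\<chi> i j. A i j x))"
    by (intro torus_cont_det torus_cont_arith cont)+
  have [simp]: "torus_cont ?Q" by simp
  have "- 2 * cell_int (\<lambda>x. \<Sum>j\<in>UNIV. \<Sum>i\<in>UNIV. \<Sum>k\<in>UNIV. A i j x * A k j x * A i k x)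
      = - 8 * cell_int (\<lambda>x. det (?S x))"
    unfolding square_grad_det_identity[of "\<lambda>i j. A i j _", OF div_free]
    by (simp add: cell_int_arith cell_int_det_grad[OF partial])
  also have "\<dots> = cell_int (\<lambda>x. - 8 * det (?S x))"
    by (simp add: cell_int_arith)
  also have "\<dots> \<le> cell_int (\<lambda>x. 4 * c * ?Q x)"
  proof (rule cell_int_mono_AE)
    show "AE x in torus. - 8 * det (?S x) \<le> 4 * c * ?Q x"
      using bound
    proof eventually_elim
      case (elim x)
      have "- 2 * det (?S x) \<le> max (l2 x) 0 * ?Q x"
        using det_bound_middle_eigenvalue[OF eig[of x]] div_free[of x] by (simp add: add.commute)
      also have "\<dots> \<le> c * ?Q x" using elim by (intro mult_right_mono sum_nonneg) auto
      finally show ?case by simp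
    qed
  qed auto
  also have "?Q = (\<lambda>x. ((\<Sum>j\<in>UNIV. \<Sum>i\<in>UNIV. A i j x * A i j x) + (\<Sum>i\<in>UNIV. \<Sum>j\<in>UNIV. A i j x * A j i x)) / 2)"
    by (simp add: fun_eq_iff sum_3 power2_eq_square field_simps)
  also have "cell_int (\<lambda>x. 4 * c * (((\<Sum>j\<in>UNIV. \<Sum>i\<in>UNIV. A i j x * A i j x) + (\<Sum>i\<in>UNIV. \<Sum>j\<in>UNIV. A i j x * A j i x)) / 2))
      = 2 * c * cell_int (\<lambda>x. \<Sum>j\<in>UNIV. \<Sum>i\<in>UNIV. A i j x * A i j x)"
    by (simp only: cell_int_arith(4,6)) (simp add: cell_int_arith(1) cell_int_trace_square)
  finally show ?thesis .
qed

end

context euler_flow begin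

lemma enstrophy_nonneg: "t \<in> {0<..<T} \<Longrightarrow> 0 \<le> enstrophy t"
  unfolding enstrophy_def cell_int_def by (intro integral_nonneg sum_nonneg) auto

text \<open>
  The argument runs with the continuous function \<open>growth / (1 + enstrophy)\<close>, the logarithmic derivative
  of \<open>1 + enstrophy\<close>, whose half is a measurable function below \<open>\<Lambda>\<close>. As \<open>\<Lambda>\<close> may fail to be measurable,
  its integral is the supremum of the integrals of such functions. The summand \<open>1\<close> avoids
  division by zero.
\<close>

lemma enstrophy_gronwall:
  fixes \<Lambda> :: "real \<Rightarrow> ennreal"
  assumes growth: "\<And>t c. t \<in> {0<..<T} \<Longrightarrow> 0 \<le> c \<Longrightarrow> \<Lambda> t \<le> ennreal c \<Longrightarrow> growth t \<le> 2 * c * enstrophy t"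
    and fin: "(\<integral>\<^sup>+ t\<in>{0<..<T}. \<Lambda> t \<partial>lborel) < \<infinity>"
    and ab: "0 < a" "a \<le> b" "b < T"
  shows "enstrophy b \<le> (1 + enstrophy a) * exp (2 * enn2real (\<integral>\<^sup>+ t\<in>{0<..<T}. \<Lambda> t \<partial>lborel))"
proof -
  let ?M = "\<integral>\<^sup>+ t\<in>{0<..<T}. \<Lambda> t \<partial>lborel"
  let ?r = "\<lambda>t. growth t / (1 + enstrophy t)"
  \<comment> \<open>The factor \<open>2\<close> is kept on this side: it could not be pulled out of the integral of a
  nonmeasurable \<open>\<Lambda>\<close>.\<close>
  let ?m = "\<lambda>t. max (?r t) 0 / 2"
  have sub: "{a..b} \<subseteq> {0<..<T}" using ab by auto
  have pos: "1 + enstrophy t > 0" if "t \<in> {a..b}" for t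
    using enstrophy_nonneg[of t] sub that by (auto simp: add_pos_nonneg)
  have "continuous_on {a..b} enstrophy"
    by (rule DERIV_continuous_on[of _ _ growth])
      (use sub in \<open>auto intro!: has_field_derivative_at_within enstrophy_derivative\<close>)
  then have cont_r: "continuous_on {a..b} ?r"
    using continuous_on_subset[OF continuous_on_growth sub] pos
    by (intro continuous_on_divide continuous_on_add continuous_on_const) force+
  have "(?r has_integral ln (1 + enstrophy b) - ln (1 + enstrophy a)) {a..b}"
  proof (rule fundamental_theorem_of_calculus[OF ab(2)])
    fix t assume t: "t \<in> {a..b}"
    then have "((\<lambda>t. ln (1 + enstrophy t)) has_real_derivative ?r t) (at t)"
      using pos[OF t] sub by (auto intro!: derivative_eq_intros enstrophy_derivative)
    then show "((\<lambda>t. ln (1 + enstrophy t)) has_vector_derivative ?r t) (at t within {a..b})"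
      unfolding has_real_derivative_iff_has_vector_derivative by (rule has_vector_derivative_at_within)
  qed
  moreover have m: "(?m has_integral integral {a..b} ?m) {a..b}"
    by (intro integrable_integral integrable_continuous_real continuous_intros cont_r) auto
  from has_integral_mult_right[OF m, of 2]
  have "((\<lambda>t. max (?r t) 0) has_integral 2 * integral {a..b} ?m) {a..b}" by simp
  ultimately have ln_le: "ln (1 + enstrophy b) - ln (1 + enstrophy a) \<le> 2 * integral {a..b} ?m"
    by (rule has_integral_le) auto
  have "ennreal (integral {a..b} ?m) = (\<integral>\<^sup>+ t. ennreal (indicator {a..b} t * ?m t) \<partial>lborel)"
    using nn_integral_has_integral_lebesgue[OF _ m] by simp
  also have "\<dots> \<le> ?M"
  proof (rule nn_integral_mono)
    fix t
    show "ennreal (indicator {a..b} t * ?m t) \<le> \<Lambda> t * indicator {0<..<T} t"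
    proof (cases "t \<in> {a..b} \<and> \<Lambda> t < \<infinity>")
      case False
      then have "t \<notin> {a..b} \<or> t \<in> {0<..<T} \<and> \<Lambda> t = \<infinity>"
        using sub by (auto simp: less_top[symmetric])
      then show ?thesis by auto
    next
      case True
      define c where "c = enn2real (\<Lambda> t)"
      have c: "\<Lambda> t = ennreal c" "c \<ge> 0" using True by (auto simp: c_def)
      have t: "t \<in> {0<..<T}" using True sub by auto
      have "growth t \<le> 2 * c * enstrophy t" using growth[OF t c(2)] c(1) by simp
      also have "\<dots> \<le> 2 * c * (1 + enstrophy t)" using c(2) by (simp add: mult_left_mono)
      finally have "?r t \<le> 2 * c" using pos[of t] True by (simp add: pos_divide_le_eq)
      then have "?m t \<le> c" using c(2) by simp
      then show ?thesis using True t c(1) by (simp add: ennreal_leI)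
    qed
  qed
  finally have "enn2real (ennreal (integral {a..b} ?m)) \<le> enn2real ?M"
    using fin by (intro enn2real_mono) auto
  moreover have "0 \<le> integral {a..b} ?m" using m by (rule has_integral_nonneg) simp
  ultimately have "integral {a..b} ?m \<le> enn2real ?M" by simp
  then have "ln (1 + enstrophy b) \<le> ln (1 + enstrophy a) + 2 * enn2real ?M" using ln_le by simp
  then have "exp (ln (1 + enstrophy b)) \<le> exp (ln (1 + enstrophy a) + 2 * enn2real ?M)" by simp
  then show ?thesis using pos[of a] pos[of b] ab by (simp add: exp_add)
qed

end

section \<open>Classical solutions\<close>

lemma line_derivative_partial:
  assumes "f differentiable (at x)"
  shows "((\<lambda>s. f (x + s *\<^sub>R axis j 1)) has_real_derivative partial j f x) (at 0)"
proof -
  let ?L = "frechet_derivative f (at x)" and ?e = "axis j 1 :: real^3"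
  have L: "(f has_derivative ?L) (at x)"
    using assms frechet_derivative_works by blast
  have "((\<lambda>s. x + s *\<^sub>R ?e) has_derivative (\<lambda>s. s *\<^sub>R ?e)) (at 0)"
    by (auto intro!: derivative_eq_intros)
  from has_derivative_compose[OF this, of f ?L] L
  have "((\<lambda>s. f (x + s *\<^sub>R ?e)) has_derivative (\<lambda>s. ?L (s *\<^sub>R ?e))) (at 0)" by simp
  moreover have "?L (s *\<^sub>R ?e) = partial j f x * s" for s
    using linear_scale[OF has_derivative_linear[OF L], of s ?e] by (simp add: partial_def)
  ultimately show ?thesis by (simp add: has_field_derivative_def)
qed

lemma has_torus_partial_partial:
  assumes per: "periodic f" and diff: "\<And>x. f differentiable (at x)"
    and cont: "continuous_on UNIV (partial j f)"
  shows "has_torus_partial j f (partial j f)"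
proof -
  have "partial j f (x + axis i 1) = partial j f x" for x i
  proof -
    have "(\<lambda>s. f (x + axis i 1 + s *\<^sub>R axis j 1)) = (\<lambda>s. f (x + s *\<^sub>R axis j 1))"
      using per unfolding periodic_def by (metis (no_types, opaque_lifting) add.commute add.assoc)
    then show ?thesis
      using line_derivative_partial[OF diff, of "x + axis i 1" j] line_derivative_partial[OF diff, of x j]
      by (metis DERIV_unique)
  qed
  moreover have "continuous_on UNIV f"
    using diff by (simp add: differentiable_imp_continuous_within continuous_on_eq_continuous_within)
  ultimately show ?thesis
    using assms line_derivative_partial[OF diff]
    by (auto simp: has_torus_partial_def torus_cont_def periodic_def)
qed

lemma sobolev_periodic: "f \<in> sobolev m \<Longrightarrow> periodic f"
  by (cases m) (auto simp: L2_torus_def)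

text \<open>
  Membership in the Sobolev space supplies periodicity in space, and joint differentiability all the
  continuity statements for the velocity. The pressure gradient is continuous because the equation
  expresses it through \<open>v\<close>.
\<close>

lemma classical_euler_solution_flow:
  assumes "classical_euler_solution m T v0 v p"
  shows "euler_flow T (\<lambda>t i x. v t x $ i) (\<lambda>t i x. vector_derivative (\<lambda>s. v s x) (at t) $ i)
    (\<lambda>t i. partial i (p t)) (\<lambda>t i j. partial j (\<lambda>y. v t y $ i)) p"
proof -
  let ?S = "{0<..<T}"
  let ?F = "\<lambda>(t, x). v t x"
  let ?A = "\<lambda>t i j. partial j (\<lambda>y. v t y $ i)" and ?W = "\<lambda>t i x. vector_derivative (\<lambda>s. v s x) (at t) $ i"
  define L where "L z = frechet_derivative ?F (at z)" for z
  have sob: "cont_into_sobolev_sigma m T v" and C1: "C1_on (?S \<times> UNIV) ?F"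
    and p: "\<And>t. t \<in> ?S \<Longrightarrow> periodic (p t)" "\<And>t x. t \<in> ?S \<Longrightarrow> p t differentiable (at x)"
    and eq: "\<And>t x. t \<in> ?S \<Longrightarrow> vector_derivative (\<lambda>s. v s x) (at t) + convect (v t) (v t) x = - gradient (p t) x"
    and div: "\<And>t x. t \<in> ?S \<Longrightarrow> divergence (v t) x = 0"
    using assms unfolding classical_euler_solution_def by blast+
  have L: "(?F has_derivative L z) (at z)" if "z \<in> ?S \<times> UNIV" for z
    using C1 that unfolding C1_on_def L_def by (metis frechet_derivative_works)
  have L_cont: "continuous_on (?S \<times> UNIV) (\<lambda>z. L z h)" for h
    using C1 unfolding C1_on_def L_def by blast
  have space: "((\<lambda>y. v t y $ i) has_derivative (\<lambda>h. L (t, x) (0, h) $ i)) (at x)" if t: "t \<in> ?S" for t x i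
  proof -
    have "((\<lambda>y. (t, y)) has_derivative (\<lambda>h. (0, h))) (at x)"
      by (auto intro!: derivative_eq_intros)
    from has_derivative_compose[OF this L] t
    have "((\<lambda>y. v t y) has_derivative (\<lambda>h. L (t, x) (0, h))) (at x)" by simp
    from bounded_linear.has_derivative[OF bounded_linear_vec_nth this] show ?thesis .
  qed
  have A: "?A t i j x = L (t, x) (0, axis j 1) $ i" if "t \<in> ?S" for t i j x
    unfolding partial_def using frechet_derivative_at[OF space[OF that]] by metis
  have time: "((\<lambda>s. v s x) has_vector_derivative L (t, x) (1, 0)) (at t)" if t: "t \<in> ?S" for t x
  proof -
    have "((\<lambda>s. (s, x)) has_derivative (\<lambda>h. (h, 0))) (at t)"
      by (auto intro!: derivative_eq_intros)
    from has_derivative_compose[OF this L] t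
    have "((\<lambda>s. v s x) has_derivative (\<lambda>h. L (t, x) (h, 0))) (at t)" by simp
    moreover have "(\<lambda>h. L (t, x) (h, 0)) = (\<lambda>h. h *\<^sub>R L (t, x) (1, 0))"
    proof
      fix h
      show "L (t, x) (h, 0) = h *\<^sub>R L (t, x) (1, 0)"
        using linear_scale[OF has_derivative_linear[OF L[of "(t, x)"]], of h "(1, 0)"] t by simp
    qed
    ultimately show ?thesis by (simp only: has_vector_derivative_def)
  qed
  have W: "?W t i x = L (t, x) (1, 0) $ i" if "t \<in> ?S" for t i x
    using vector_derivative_at[OF time[OF that]] by simp
  have W_deriv: "((\<lambda>s. v s x $ i) has_real_derivative ?W t i x) (at t)" if "t \<in> ?S" for t i x
    unfolding W[OF that] has_real_derivative_iff_has_vector_derivative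
    by (rule bounded_linear.has_vector_derivative[OF bounded_linear_vec_nth time[OF that]])
  have cont_v: "continuous_on (?S \<times> UNIV) (\<lambda>z. v (fst z) (snd z) $ i)" for i
  proof -
    have "continuous_on (?S \<times> UNIV) ?F"
      by (intro continuous_at_imp_continuous_on ballI has_derivative_continuous[OF L])
    then show ?thesis by (intro continuous_on_component) (simp add: case_prod_unfold)
  qed
  have cont_A: "continuous_on (?S \<times> UNIV) (\<lambda>z. ?A (fst z) i j (snd z))" for i j
    by (rule continuous_on_eq[OF continuous_on_component[OF L_cont[of "(0, axis j 1)"], of i]]) (auto simp: A)
  have cont_W: "continuous_on (?S \<times> UNIV) (\<lambda>z. ?W (fst z) i (snd z))" for i
    by (rule continuous_on_eq[OF continuous_on_component[OF L_cont[of "(1, 0)"], of i]]) (auto simp: W)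
  have slice: "continuous_on UNIV (f t)"
    if "continuous_on (?S \<times> UNIV) (\<lambda>z. f (fst z) (snd z))" "t \<in> ?S" for f :: "real \<Rightarrow> real^3 \<Rightarrow> real" and t
  proof -
    have "continuous_on UNIV (\<lambda>x. f (fst (t, x)) (snd (t, x)))"
      by (rule continuous_on_compose2[OF that(1)]) (use that(2) in \<open>auto intro!: continuous_intros\<close>)
    then show ?thesis by simp
  qed
  have per: "periodic (\<lambda>x. v t x $ i)" if "t \<in> ?S" for t i
    using sob that unfolding cont_into_sobolev_sigma_def sobolev_sigma_def
    by (auto intro!: sobolev_periodic[of _ m])
  have euler: "?W t i x + (\<Sum>k\<in>UNIV. v t x $ k * ?A t i k x) = - partial i (p t) x" if "t \<in> ?S" for t i x
    using arg_cong[OF eq[OF that, of x], of "\<lambda>u. u $ i"] by (simp add: convect_def gradient_def)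
  have P_cont: "continuous_on UNIV (partial i (p t))" if t: "t \<in> ?S" for t i
  proof -
    have "partial i (p t) = (\<lambda>x. - (?W t i x + (\<Sum>k\<in>UNIV. v t x $ k * ?A t i k x)))"
      by (simp add: fun_eq_iff euler[OF t])
    moreover have "continuous_on UNIV (\<lambda>x. - (?W t i x + (\<Sum>k\<in>UNIV. v t x $ k * ?A t i k x)))"
      by (intro continuous_on_minus continuous_on_add continuous_on_sum continuous_on_mult
          slice[OF cont_W t] slice[OF cont_A t] slice[OF cont_v t])
    ultimately show ?thesis by (simp only:)
  qed
  show ?thesis
  proof
    fix t x i j assume t: "t \<in> ?S"
    show "has_torus_partial j (\<lambda>x. v t x $ i) (?A t i j)"
      by (rule has_torus_partial_partial[OF per[OF t] _ slice[OF cont_A t]])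
        (use space[OF t] in \<open>auto simp: differentiable_def\<close>)
    show "(\<Sum>i\<in>UNIV. ?A t i i x) = 0"
      using div[OF t, of x] by (simp add: divergence_def)
    show "has_torus_partial i (p t) (partial i (p t))"
      by (rule has_torus_partial_partial[OF p(1)[OF t] p(2)[OF t] P_cont[OF t]])
  qed (use euler W_deriv cont_v cont_A cont_W in auto)
qed

text \<open>
  With \<open>A\<close> the gradient of \<open>u\<close>, pointwise \<open>|curl u|\<^sup>2 = |A|\<^sup>2 - tr A\<^sup>2\<close>, and \<open>tr A\<^sup>2\<close> integrates to zero.
\<close>

lemma L2_norm_curl:
  assumes "torus_flow (\<lambda>i x. u x $ i) (\<lambda>i j. partial j (\<lambda>y. u y $ i))"
  shows "(L2_norm (curl u))\<^sup>2 = cell_int (\<lambda>x. \<Sum>j\<in>UNIV. \<Sum>i\<in>UNIV. partial j (\<lambda>y. u y $ i) x * partial j (\<lambda>y. u y $ i) x)"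
proof -
  interpret torus_flow "\<lambda>i x. u x $ i" "\<lambda>i j. partial j (\<lambda>y. u y $ i)" by fact
  let ?A = "\<lambda>i j. partial j (\<lambda>y. u y $ i)"
  have "(norm (curl u x))\<^sup>2 = (\<Sum>j\<in>UNIV. \<Sum>i\<in>UNIV. ?A i j x * ?A i j x)
      - (\<Sum>i\<in>UNIV. \<Sum>j\<in>UNIV. ?A i j x * ?A j i x)" for x
    unfolding power2_norm_eq_inner inner_vec_def curl_def
    by (simp add: sum_3 algebra_simps)
  moreover have nonneg: "0 \<le> (LINT x|torus. (norm (curl u x))\<^sup>2)"
    by (rule Bochner_Integration.integral_nonneg) simp
  ultimately have "(LINT x|torus. (norm (curl u x))\<^sup>2) = cell_int (\<lambda>x. (\<Sum>j\<in>UNIV. \<Sum>i\<in>UNIV. ?A i j x * ?A i j x)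
      - (\<Sum>i\<in>UNIV. \<Sum>j\<in>UNIV. ?A i j x * ?A j i x))"
    by (simp add: cell_int_eq_lebesgue)
  also have "\<dots> = cell_int (\<lambda>x. \<Sum>j\<in>UNIV. \<Sum>i\<in>UNIV. ?A i j x * ?A i j x)"
    by (simp add: cell_int_arith(2) cell_int_trace_square)
  finally show ?thesis
    unfolding L2_norm_def using real_sqrt_pow2[OF nonneg] by simp
qed

theorem corollary2p1:
  fixes m :: nat and T :: real
    and v0 :: "real^3 \<Rightarrow> real^3"
    and v :: "real \<Rightarrow> real^3 \<Rightarrow> real^3"
    and p :: "real \<Rightarrow> real^3 \<Rightarrow> real"
    and lam1 lam2 lam3 :: "real \<Rightarrow> real^3 \<Rightarrow> real"
  assumes "real m > 5 / 2"
    and "v0 \<in> sobolev_sigma m"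
    and "0 < T"
    and "classical_euler_solution m T v0 v p"
    and "\<And>t x. t \<in> {0<..<T} \<Longrightarrow>
      ordered_eigenvalues (deformation (v t) x) (lam1 t x) (lam2 t x) (lam3 t x)"
    and "Limsup (at_left T) (\<lambda>t. ereal (L2_norm (curl (v t)))) = \<infinity>"
  shows "(\<integral>\<^sup>+ t\<in>{0<..<T}. Linf_norm (\<lambda>x. max (lam2 t x) 0) \<partial>lborel) = \<infinity>"
proof (rule ccontr)
  let ?\<Lambda> = "\<lambda>t. Linf_norm (\<lambda>x. max (lam2 t x) 0)"
  assume "(\<integral>\<^sup>+ t\<in>{0<..<T}. ?\<Lambda> t \<partial>lborel) \<noteq> \<infinity>"
  then have fin: "(\<integral>\<^sup>+ t\<in>{0<..<T}. ?\<Lambda> t \<partial>lborel) < \<infinity>" by (simp add: less_top)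
  interpret euler_flow T "\<lambda>t i x. v t x $ i" "\<lambda>t i x. vector_derivative (\<lambda>s. v s x) (at t) $ i"
    "\<lambda>t i. partial i (p t)" "\<lambda>t i j. partial j (\<lambda>y. v t y $ i)" p
    by (rule classical_euler_solution_flow) fact
  have "growth t \<le> 2 * c * enstrophy t" if t: "t \<in> {0<..<T}" and c: "0 \<le> c" "?\<Lambda> t \<le> ennreal c" for t c
    unfolding growth_def enstrophy_def
  proof (rule torus_flow.growth_bound[OF flow[OF t] _ c(1)])
    show "ordered_eigenvalues (\<chi> i j. (partial i (\<lambda>y. v t y $ j) x + partial j (\<lambda>y. v t y $ i) x) / 2)
        (lam1 t x) (lam2 t x) (lam3 t x)" for x
      using assms(5)[OF t, of x] by (simp add: deformation_def)
    \<comment> \<open>The essential supremum of a nonmeasurable function is infinite by convention, so this bound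
    holds in every case in which the norm is finite.\<close>
    show "AE x in torus. max (lam2 t x) 0 \<le> c"
      using esssup_AE[where M = torus and f = "\<lambda>x. ennreal \<bar>max (lam2 t x) 0\<bar>"]
    proof eventually_elim
      case (elim x)
      then have "ennreal \<bar>max (lam2 t x) 0\<bar> \<le> ennreal c"
        using c(2) unfolding Linf_norm_def by (rule order_trans)
      then show ?case using c(1) by simp
    qed
  qed
  note gronwall = enstrophy_gronwall[OF this fin]
  define a where "a = T / 2"
  define C where "C = (1 + enstrophy a) * exp (2 * enn2real (\<integral>\<^sup>+ t\<in>{0<..<T}. ?\<Lambda> t \<partial>lborel))"
  have a: "0 < a" "a < T" using \<open>0 < T\<close> by (auto simp: a_def)
  have "L2_norm (curl (v t)) \<le> sqrt C" if t: "t \<in> {a<..<T}" for t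
  proof -
    have "(L2_norm (curl (v t)))\<^sup>2 = enstrophy t"
      unfolding enstrophy_def by (rule L2_norm_curl[OF flow]) (use t a in auto)
    also have "\<dots> \<le> C"
      unfolding C_def by (rule gronwall) (use t a in auto)
    finally show ?thesis by (rule real_le_rsqrt)
  qed
  then have "\<forall>\<^sub>F t in at_left T. ereal (L2_norm (curl (v t))) \<le> ereal (sqrt C)"
    using a by (intro eventually_at_leftI[of a]) auto
  then have "Limsup (at_left T) (\<lambda>t. ereal (L2_norm (curl (v t)))) \<le> ereal (sqrt C)"
    by (rule Limsup_bounded)
  then show False using assms(6) by simp
qed

end
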